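(* Let $F:(N^n,g_N)\to(B^b,\varphi,\xi,\eta,g_B)$ be an anti-invariant Riemannian map from a Riemannian manifold $N$ to a Sasakian manifold $B$, such that the Reeb vector field $\xi$ lies in $(\mathrm{range}F_* )^\perp$ and $(\mathrm{range}F_* )^\perp$ is a totally geodesic distribution of $TB$. Let $\gamma:I\to N$ be a geodesic on $N$ and let $\sigma=F\circ\gamma$. Let $F_*Y_1\in\Gamma(\mathrm{range}F_* )$ and $Z\in\Gamma(\mathrm{range}F_* )^\perp$ be the components of $\dot\sigma(t)$ (so $\dot\sigma=F_*Y_1+Z$), let $Y\in\Gamma(\ker F_* )^\perp$ be such that $F_*Y=\mathcal{B}Z$, and let $v=g_B(\dot\sigma,\dot\sigma)$. Then $\sigma$ is a geodesic on $B$ if and only if both $$-\mathcal{S}_{\varphi F_*Y_1}F_*Y_1-\mathcal{S}_{\mathcal{C}Z}F_*Y_1+\nabla^B_ZF_*Y+F_*(\mathcal{H}\nabla^N_{Y_1}Y)+\eta(Z)F_*Y_1=0$$ and $$(\nabla F_* )(Y_1,Y)+\nabla^{F\perp}_{Y_1}\varphi F_*Y_1+\nabla^{F\perp}_Z\varphi F_*Y_1+\nabla^{F\perp}_Z\mathcal{C}Z+\nabla^{F\perp}_{Y_1}\mathcal{C}Z-v\,\xi+\eta(Z)Z=0 .$$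
   Context: A Sasakian manifold $(B,\varphi,\xi,\eta,g_B)$ is an odd-dimensional Riemannian manifold with a $(1,1)$-tensor $\varphi$, a vector field $\xi$ (Reeb field) and a 1-form $\eta$ satisfying $\varphi^2=-I+\eta\otimes\xi$, $\varphi\xi=0$, $\eta\circ\varphi=0$, $\eta(\xi)=1$, $g_B(\varphi U,\varphi V)=g_B(U,V)-\eta(U)\eta(V)$, $g_B(\varphi U,V)=-g_B(U,\varphi V)$, $\eta(U)=g_B(U,\xi)$, and, with $\nabla^B$ the Levi-Civita connection of $g_B$, $(\nabla^B_U\varphi)V=g_B(U,V)\xi-\eta(V)U$ and $\nabla^B_U\xi=-\varphi U$. A Riemannian map is a smooth map $F:(N^n,g_N)\to(B^b,g_B)$ of constant rank with $0<\mathrm{rank}F<\min\{n,b\}$ such that $F_*$ restricts to an isometry from $(\ker F_* )^\perp$ onto $\mathrm{range}F_*$ at each point. $\mathcal H$ denotes orthogonal projection of $TN$ onto $(\ker F_* )^\perp$, and $\nabla^N$ is the Levi-Civita connection of $g_N$. $F$ is anti-invariant if $\varphi(\mathrm{range}F_{*y})\subset(\mathrm{range}F_{*y})^\perp$ for every $y\in N$. Then $(\mathrm{range}F_* )^\perp=\varphi(\mathrm{range}F_* )\oplus\mu$ orthogonally, and for $Z\in\Gamma(\mathrm{range}F_* )^\perp$ one writes $\varphi Z=\mathcal{B}Z+\mathcal{C}Z$ with $\mathcal{B}Z\in\Gamma(\mathrm{range}F_* )$, $\mathcal{C}Z\in\Gamma(\mu)$. The second fundamental form of $F$ is $(\nabla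 F_* )(X,Y)=\overset{B}{\nabla^F_X}F_*Y-F_*(\nabla^N_XY)$, with $\overset{B}{\nabla^F}$ the pullback connection (so $\overset{B}{\nabla^F_{X}}F_*Y\circ F=\nabla^B_{F_*X}F_*Y$). For $V\in\Gamma(\mathrm{range}F_* )^\perp$, $\nabla^B_{F_*X}V=-\mathcal{S}_VF_*X+\nabla^{F\perp}_XV$, where $-\mathcal{S}_VF_*X$ is the component in $\mathrm{range}F_*$ and $\nabla^{F\perp}_XV$ the component in $(\mathrm{range}F_* )^\perp$. For $Z,V\in\Gamma(\mathrm{range}F_* )^\perp$, $\nabla^{F\perp}_ZV$ denotes the orthogonal projection of $\nabla^B_ZV$ onto $(\mathrm{range}F_* )^\perp$. The distribution $(\mathrm{range}F_* )^\perp$ is totally geodesic if $\nabla^B_ZV\in\Gamma(\mathrm{range}F_* )^\perp$ for all $Z,V\in\Gamma(\mathrm{range}F_* )^\perp$. *)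

theory Defs
  imports "HOL-Analysis.Analysis" "HOL-Library.Function_Algebras"
begin

section \<open>Smooth manifolds\<close>

text \<open>Only used on open sets \<open>S\<close>; continuity of all directional derivatives of order at most
  \<open>k\<close> is then the usual \<open>C\<^sup>k\<close> condition.\<close>

primrec Ck_on :: "nat \<Rightarrow> 'e::euclidean_space set \<Rightarrow> ('e \<Rightarrow> 'f::euclidean_space) \<Rightarrow> bool" where
  "Ck_on 0 S f \<longleftrightarrow> continuous_on S f"
| "Ck_on (Suc k) S f \<longleftrightarrow>
     (\<exists>f'. (\<forall>x\<in>S. (f has_derivative f' x) (at x)) \<and> (\<forall>v. Ck_on k S (\<lambda>x. f' x v)))"

definition smooth_on :: "'e::euclidean_space set \<Rightarrow> ('e \<Rightarrow> 'f::euclidean_space) \<Rightarrow> bool" where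
  "smooth_on S f \<longleftrightarrow> (\<forall>k. Ck_on k S f)"

text \<open>A manifold modelled on \<open>'e\<close>, hence of dimension \<open>DIM('e)\<close>; a chart is a pair of its domain and
  its coordinate map.\<close>

record ('a, 'e) mfd =
  mtop :: "'a topology"
  atlas :: "('a set \<times> ('a \<Rightarrow> 'e)) set"

abbreviation pts :: "('a, 'e) mfd \<Rightarrow> 'a set" where
  "pts M \<equiv> topspace (mtop M)"

definition smooth_manifold :: "('a, 'e::euclidean_space) mfd \<Rightarrow> bool" where
  "smooth_manifold M \<longleftrightarrow>
     Hausdorff_space (mtop M) \<and> second_countable (mtop M) \<and>
     pts M = (\<Union>(U, c)\<in>atlas M. U) \<and>
     (\<forall>(U, c)\<in>atlas M. openin (mtop M) U \<and> open (c ` U) \<and>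
        homeomorphic_map (subtopology (mtop M) U) (top_of_set (c ` U)) c) \<and>
     (\<forall>(U, c)\<in>atlas M. \<forall>(V, d)\<in>atlas M. smooth_on (c ` (U \<inter> V)) (d \<circ> inv_into U c))"

definition smooth_fun_on :: "('a, 'e::euclidean_space) mfd \<Rightarrow> 'a set \<Rightarrow> ('a \<Rightarrow> real) \<Rightarrow> bool" where
  "smooth_fun_on M W f \<longleftrightarrow> openin (mtop M) W \<and>
     (\<forall>(U, c)\<in>atlas M. smooth_on (c ` (U \<inter> W)) (f \<circ> inv_into U c))"

definition smooth_fun_at :: "('a, 'e::euclidean_space) mfd \<Rightarrow> 'a \<Rightarrow> ('a \<Rightarrow> real) \<Rightarrow> bool" where
  "smooth_fun_at M p f \<longleftrightarrow> (\<exists>W. p \<in> W \<and> smooth_fun_on M W f)"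

definition smooth_map ::
    "('a, 'e::euclidean_space) mfd \<Rightarrow> ('b, 'f::euclidean_space) mfd \<Rightarrow> ('a \<Rightarrow> 'b) \<Rightarrow> bool" where
  "smooth_map M M' F \<longleftrightarrow> continuous_map (mtop M) (mtop M') F \<and>
     (\<forall>(U, c)\<in>atlas M. \<forall>(V, d)\<in>atlas M'.
        smooth_on (c ` (U \<inter> F -` V)) (d \<circ> F \<circ> inv_into U c))"

definition interval_mfd :: "real set \<Rightarrow> (real, real) mfd" where
  "interval_mfd I = \<lparr>mtop = top_of_set I, atlas = {(I, \<lambda>t. t)}\<rparr>"


section \<open>Tangent vectors and vector fields\<close>

text \<open>Tangent vectors at \<open>p\<close> are derivations on the functions that are smooth near \<open>p\<close>. They are
  extended by \<open>0\<close> to all functions, so that equality of tangent vectors is equality of functionals;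
  that they depend only on germs follows from the Leibniz rule.\<close>

type_synonym 'a tvec = "('a \<Rightarrow> real) \<Rightarrow> real"

instantiation "fun" :: (type, real_vector) real_vector
begin

definition scaleR_fun :: "real \<Rightarrow> ('a \<Rightarrow> 'b) \<Rightarrow> 'a \<Rightarrow> 'b" where
  "scaleR_fun c v = (\<lambda>x. c *\<^sub>R v x)"

instance
  by standard (simp_all add: scaleR_fun_def plus_fun_def scaleR_add_left scaleR_add_right)

end

definition tangent_space :: "('a, 'e::euclidean_space) mfd \<Rightarrow> 'a \<Rightarrow> 'a tvec set" where
  "tangent_space M p = {v.
     (\<forall>f. \<not> smooth_fun_at M p f \<longrightarrow> v f = 0) \<and>
     (\<forall>f h. smooth_fun_at M p f \<longrightarrow> smooth_fun_at M p h \<longrightarrow>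
        v (\<lambda>q. f q + h q) = v f + v h \<and>
        v (\<lambda>q. f q * h q) = v f * h p + f p * v h) \<and>
     (\<forall>a f. smooth_fun_at M p f \<longrightarrow> v (\<lambda>q. a * f q) = a * v f)}"

text \<open>The differential \<open>F\<^sub>*\<close> at \<open>p\<close>.\<close>

definition push :: "('b, 'f::euclidean_space) mfd \<Rightarrow> ('a \<Rightarrow> 'b) \<Rightarrow> 'a \<Rightarrow> 'a tvec \<Rightarrow> 'b tvec" where
  "push M' F p v = (\<lambda>f. if smooth_fun_at M' (F p) f then v (f \<circ> F) else 0)"

definition smooth_field_on :: "('a, 'e::euclidean_space) mfd \<Rightarrow> 'a set \<Rightarrow> ('a \<Rightarrow> 'a tvec) \<Rightarrow> bool" where
  "smooth_field_on M W X \<longleftrightarrow> openin (mtop M) W \<and> (\<forall>p\<in>W. X p \<in> tangent_space M p) \<and>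
     (\<forall>V f. V \<subseteq> W \<longrightarrow> smooth_fun_on M V f \<longrightarrow> smooth_fun_on M V (\<lambda>p. X p f))"

definition smooth_field_at :: "('a, 'e::euclidean_space) mfd \<Rightarrow> 'a \<Rightarrow> ('a \<Rightarrow> 'a tvec) \<Rightarrow> bool" where
  "smooth_field_at M p X \<longleftrightarrow> (\<exists>W. p \<in> W \<and> smooth_field_on M W X)"

definition lie_bracket ::
    "('a, 'e::euclidean_space) mfd \<Rightarrow> ('a \<Rightarrow> 'a tvec) \<Rightarrow> ('a \<Rightarrow> 'a tvec) \<Rightarrow> 'a \<Rightarrow> 'a tvec" where
  "lie_bracket M X Y p = (\<lambda>f. if smooth_fun_at M p f
     then X p (\<lambda>q. Y q f) - Y p (\<lambda>q. X q f) else 0)"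

definition ddt :: "real set \<Rightarrow> real \<Rightarrow> real tvec" where
  "ddt I t = (\<lambda>f. if smooth_fun_at (interval_mfd I) t f then deriv f t else 0)"

definition velocity ::
    "('a, 'e::euclidean_space) mfd \<Rightarrow> real set \<Rightarrow> (real \<Rightarrow> 'a) \<Rightarrow> real \<Rightarrow> 'a tvec" where
  "velocity M I \<gamma> t = push M \<gamma> t (ddt I t)"


section \<open>Metrics and connections\<close>

type_synonym 'a metric = "'a \<Rightarrow> 'a tvec \<Rightarrow> 'a tvec \<Rightarrow> real"

definition riemannian_metric :: "('a, 'e::euclidean_space) mfd \<Rightarrow> 'a metric \<Rightarrow> bool" where
  "riemannian_metric M g \<longleftrightarrow>
     (\<forall>p\<in>pts M. \<forall>u\<in>tangent_space M p. \<forall>v\<in>tangent_space M p.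
        g p u v = g p v u \<and> (u \<noteq> 0 \<longrightarrow> g p u u > 0) \<and>
        (\<forall>w\<in>tangent_space M p. g p (u + v) w = g p u w + g p v w) \<and>
        (\<forall>a. g p (a *\<^sub>R u) v = a * g p u v)) \<and>
     (\<forall>W X Y. smooth_field_on M W X \<longrightarrow> smooth_field_on M W Y \<longrightarrow>
        smooth_fun_on M W (\<lambda>p. g p (X p) (Y p)))"

text \<open>A connection is given as \<open>nab p v Y\<close>, the covariant derivative \<open>\<nabla>\<^sub>v Y\<close> at \<open>p\<close> of a vector field
  \<open>Y\<close>, smooth near \<open>p\<close>, in the direction of a vector \<open>v\<close> at \<open>p\<close>.\<close>

type_synonym 'a conn = "'a \<Rightarrow> 'a tvec \<Rightarrow> ('a \<Rightarrow> 'a tvec) \<Rightarrow> 'a tvec"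

definition connection :: "('a, 'e::euclidean_space) mfd \<Rightarrow> 'a conn \<Rightarrow> bool" where
  "connection M nab \<longleftrightarrow>
     (\<forall>p\<in>pts M. \<forall>v\<in>tangent_space M p. \<forall>Y. smooth_field_at M p Y \<longrightarrow>
        nab p v Y \<in> tangent_space M p \<and>
        (\<forall>w\<in>tangent_space M p. nab p (v + w) Y = nab p v Y + nab p w Y) \<and>
        (\<forall>a. nab p (a *\<^sub>R v) Y = a *\<^sub>R nab p v Y) \<and>
        (\<forall>Y'. smooth_field_at M p Y' \<longrightarrow> nab p v (\<lambda>q. Y q + Y' q) = nab p v Y + nab p v Y') \<and>
        (\<forall>f. smooth_fun_at M p f \<longrightarrow>
           nab p v (\<lambda>q. f q *\<^sub>R Y q) = v f *\<^sub>R Y p + f p *\<^sub>R nab p v Y)) \<and>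
     (\<forall>W X Y. smooth_field_on M W X \<longrightarrow> smooth_field_on M W Y \<longrightarrow>
        smooth_field_on M W (\<lambda>p. nab p (X p) Y))"

definition torsion_free :: "('a, 'e::euclidean_space) mfd \<Rightarrow> 'a conn \<Rightarrow> bool" where
  "torsion_free M nab \<longleftrightarrow>
     (\<forall>p X Y. smooth_field_at M p X \<longrightarrow> smooth_field_at M p Y \<longrightarrow>
        nab p (X p) Y - nab p (Y p) X = lie_bracket M X Y p)"

definition metric_compatible ::
    "('a, 'e::euclidean_space) mfd \<Rightarrow> 'a metric \<Rightarrow> 'a conn \<Rightarrow> bool" where
  "metric_compatible M g nab \<longleftrightarrow>
     (\<forall>p\<in>pts M. \<forall>v\<in>tangent_space M p. \<forall>X Y. smooth_field_at M p X \<longrightarrow> smooth_field_at M p Y \<longrightarrow>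
        v (\<lambda>q. g q (X q) (Y q)) = g p (nab p v X) (Y p) + g p (X p) (nab p v Y))"

definition levi_civita :: "('a, 'e::euclidean_space) mfd \<Rightarrow> 'a metric \<Rightarrow> 'a conn \<Rightarrow> bool" where
  "levi_civita M g nab \<longleftrightarrow> connection M nab \<and> torsion_free M nab \<and> metric_compatible M g nab"

definition riemannian_manifold ::
    "('a, 'e::euclidean_space) mfd \<Rightarrow> 'a metric \<Rightarrow> 'a conn \<Rightarrow> bool" where
  "riemannian_manifold M g nab \<longleftrightarrow>
     smooth_manifold M \<and> riemannian_metric M g \<and> levi_civita M g nab"

text \<open>The pullback connection: near \<open>p\<close>, a section \<open>V\<close> of \<open>F\<^sup>*TM'\<close> is a combination
  \<open>\<Sum>a\<^sub>i (E\<^sub>i \<circ> F)\<close> with smooth functions \<open>a\<^sub>i\<close> on \<open>M\<close> and local vector fields \<open>E\<^sub>i\<close> on \<open>M'\<close>, and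
  \<open>\<nabla>\<^sub>v V = \<Sum> v(a\<^sub>i) E\<^sub>i(F p) + a\<^sub>i(p) \<nabla>'\<^bsub>F\<^sub>*v\<^esub> E\<^sub>i\<close>, independently of the combination chosen.\<close>

definition pullback_cov ::
    "('a, 'e::euclidean_space) mfd \<Rightarrow> ('b, 'f::euclidean_space) mfd \<Rightarrow> 'b conn \<Rightarrow> ('a \<Rightarrow> 'b) \<Rightarrow>
     'a \<Rightarrow> 'a tvec \<Rightarrow> ('a \<Rightarrow> 'b tvec) \<Rightarrow> 'b tvec" where
  "pullback_cov M M' nab' F p v V = (THE w. \<exists>(k::nat) a E W.
     openin (mtop M) W \<and> p \<in> W \<and>
     (\<forall>i<k. smooth_fun_on M W (a i) \<and> smooth_field_at M' (F p) (E i)) \<and>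
     (\<forall>q\<in>W. V q = (\<Sum>i<k. a i q *\<^sub>R E i (F q))) \<and>
     w = (\<Sum>i<k. v (a i) *\<^sub>R E i (F p) + a i p *\<^sub>R nab' (F p) (push M' F p v) (E i)))"

definition geodesic ::
    "('a, 'e::euclidean_space) mfd \<Rightarrow> 'a conn \<Rightarrow> real set \<Rightarrow> (real \<Rightarrow> 'a) \<Rightarrow> bool" where
  "geodesic M nab I \<gamma> \<longleftrightarrow> smooth_map (interval_mfd I) M \<gamma> \<and>
     (\<forall>t\<in>I. pullback_cov (interval_mfd I) M nab \<gamma> t (ddt I t) (velocity M I \<gamma>) = 0)"


section \<open>Distributions and orthogonal projections\<close>

definition perp :: "('a, 'e::euclidean_space) mfd \<Rightarrow> 'a metric \<Rightarrow> 'a \<Rightarrow> 'a tvec set \<Rightarrow> 'a tvec set" where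
  "perp M g p S = {v \<in> tangent_space M p. \<forall>u\<in>S. g p v u = 0}"

definition orth_proj :: "'a metric \<Rightarrow> 'a \<Rightarrow> 'a tvec set \<Rightarrow> 'a tvec \<Rightarrow> 'a tvec" where
  "orth_proj g p S v = (THE w. w \<in> S \<and> (\<forall>u\<in>S. g p (v - w) u = 0))"

definition section_on ::
    "('a, 'e::euclidean_space) mfd \<Rightarrow> ('a \<Rightarrow> 'a tvec set) \<Rightarrow> 'a set \<Rightarrow> ('a \<Rightarrow> 'a tvec) \<Rightarrow> bool" where
  "section_on M D W X \<longleftrightarrow> smooth_field_on M W X \<and> (\<forall>p\<in>W. X p \<in> D p)"

definition smooth_distribution_on ::
    "('a, 'e::euclidean_space) mfd \<Rightarrow> 'a set \<Rightarrow> nat \<Rightarrow> ('a \<Rightarrow> 'a tvec set) \<Rightarrow> bool" where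
  "smooth_distribution_on M Q k D \<longleftrightarrow> openin (mtop M) Q \<and>
     (\<forall>p\<in>Q. \<exists>W E. p \<in> W \<and> W \<subseteq> Q \<and> (\<forall>i<k. smooth_field_on M W (E i)) \<and>
        openin (mtop M) W \<and>
        (\<forall>q\<in>W. inj_on (\<lambda>i. E i q) {..<k} \<and> independent ((\<lambda>i. E i q) ` {..<k}) \<and>
           D q = span ((\<lambda>i. E i q) ` {..<k})))"

definition totally_geodesic_on ::
    "('a, 'e::euclidean_space) mfd \<Rightarrow> 'a conn \<Rightarrow> 'a set \<Rightarrow> ('a \<Rightarrow> 'a tvec set) \<Rightarrow> bool" where
  "totally_geodesic_on M nab Q D \<longleftrightarrow>
     (\<forall>W Z V. W \<subseteq> Q \<longrightarrow> section_on M D W Z \<longrightarrow> section_on M D W V \<longrightarrow>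
        (\<forall>p\<in>W. nab p (Z p) V \<in> D p))"


section \<open>Sasakian manifolds\<close>

definition sasakian_manifold ::
    "('a, 'e::euclidean_space) mfd \<Rightarrow> ('a \<Rightarrow> 'a tvec \<Rightarrow> 'a tvec) \<Rightarrow> ('a \<Rightarrow> 'a tvec) \<Rightarrow>
     ('a \<Rightarrow> 'a tvec \<Rightarrow> real) \<Rightarrow> 'a metric \<Rightarrow> 'a conn \<Rightarrow> bool" where
  "sasakian_manifold M \<phi> \<xi> \<eta> g nab \<longleftrightarrow>
     riemannian_manifold M g nab \<and> odd DIM('e) \<and>
     smooth_field_on M (pts M) \<xi> \<and>
     (\<forall>W X. smooth_field_on M W X \<longrightarrow>
        smooth_field_on M W (\<lambda>p. \<phi> p (X p)) \<and> smooth_fun_on M W (\<lambda>p. \<eta> p (X p))) \<and>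
     (\<forall>p\<in>pts M. \<phi> p (\<xi> p) = 0 \<and> \<eta> p (\<xi> p) = 1 \<and>
        (\<forall>u\<in>tangent_space M p.
           \<phi> p u \<in> tangent_space M p \<and>
           \<phi> p (\<phi> p u) = - u + \<eta> p u *\<^sub>R \<xi> p \<and>
           \<eta> p (\<phi> p u) = 0 \<and>
           \<eta> p u = g p u (\<xi> p) \<and>
           nab p u \<xi> = - \<phi> p u \<and>
           (\<forall>a. \<phi> p (a *\<^sub>R u) = a *\<^sub>R \<phi> p u \<and> \<eta> p (a *\<^sub>R u) = a * \<eta> p u) \<and>
           (\<forall>v\<in>tangent_space M p.
              \<phi> p (u + v) = \<phi> p u + \<phi> p v \<and> \<eta> p (u + v) = \<eta> p u + \<eta> p v \<and>
              g p (\<phi> p u) (\<phi> p v) = g p u v - \<eta> p u * \<eta> p v \<and>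
              g p (\<phi> p u) v = - g p u (\<phi> p v)) \<and>
           (\<forall>V. smooth_field_at M p V \<longrightarrow>
              nab p u (\<lambda>q. \<phi> q (V q)) - \<phi> p (nab p u V) = g p u (V p) *\<^sub>R \<xi> p - \<eta> p (V p) *\<^sub>R u)))"


section \<open>Riemannian maps\<close>

definition kerF :: "('a, 'e::euclidean_space) mfd \<Rightarrow> ('b, 'f::euclidean_space) mfd \<Rightarrow> ('a \<Rightarrow> 'b) \<Rightarrow>
    'a \<Rightarrow> 'a tvec set" where
  "kerF N B F y = {x \<in> tangent_space N y. push B F y x = 0}"

definition rangeF :: "('a, 'e::euclidean_space) mfd \<Rightarrow> ('b, 'f::euclidean_space) mfd \<Rightarrow> ('a \<Rightarrow> 'b) \<Rightarrow>
    'a \<Rightarrow> 'b tvec set" where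
  "rangeF N B F y = push B F y ` tangent_space N y"

definition riemannian_map :: "('a, 'e::euclidean_space) mfd \<Rightarrow> 'a metric \<Rightarrow>
    ('b, 'f::euclidean_space) mfd \<Rightarrow> 'b metric \<Rightarrow> nat \<Rightarrow> ('a \<Rightarrow> 'b) \<Rightarrow> bool" where
  "riemannian_map N gN B gB r F \<longleftrightarrow>
     smooth_map N B F \<and> 0 < r \<and> r < min DIM('e) DIM('f) \<and>
     (\<forall>y\<in>pts N. dim (rangeF N B F y) = r \<and>
        push B F y ` perp N gN y (kerF N B F y) = rangeF N B F y \<and>
        (\<forall>x\<in>perp N gN y (kerF N B F y). \<forall>x'\<in>perp N gN y (kerF N B F y).
           gB (F y) (push B F y x) (push B F y x') = gN y x x'))"

definition anti_invariant :: "('a, 'e::euclidean_space) mfd \<Rightarrow> ('b, 'f::euclidean_space) mfd \<Rightarrow>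
    'b metric \<Rightarrow> ('b \<Rightarrow> 'b tvec \<Rightarrow> 'b tvec) \<Rightarrow> ('a \<Rightarrow> 'b) \<Rightarrow> bool" where
  "anti_invariant N B gB \<phi> F \<longleftrightarrow>
     (\<forall>y\<in>pts N. \<phi> (F y) ` rangeF N B F y \<subseteq> perp B gB (F y) (rangeF N B F y))"

text \<open>\<open>mu\<close> is the orthogonal complement of \<open>\<phi>(range F\<^sub>*)\<close> in \<open>(range F\<^sub>*)\<^sup>\<bottom>\<close>.\<close>

definition mu :: "('a, 'e::euclidean_space) mfd \<Rightarrow> ('b, 'f::euclidean_space) mfd \<Rightarrow>
    'b metric \<Rightarrow> ('b \<Rightarrow> 'b tvec \<Rightarrow> 'b tvec) \<Rightarrow> ('a \<Rightarrow> 'b) \<Rightarrow> 'a \<Rightarrow> 'b tvec set" where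
  "mu N B gB \<phi> F y =
     perp B gB (F y) (rangeF N B F y) \<inter> perp B gB (F y) (\<phi> (F y) ` rangeF N B F y)"

definition second_fundamental_form :: "('a, 'e::euclidean_space) mfd \<Rightarrow> 'a conn \<Rightarrow>
    ('b, 'f::euclidean_space) mfd \<Rightarrow> 'b conn \<Rightarrow> ('a \<Rightarrow> 'b) \<Rightarrow>
    ('a \<Rightarrow> 'a tvec) \<Rightarrow> ('a \<Rightarrow> 'a tvec) \<Rightarrow> 'a \<Rightarrow> 'b tvec" where
  "second_fundamental_form N nabN B nabB F X Y y =
     pullback_cov N B nabB F y (X y) (\<lambda>q. push B F q (Y q)) - push B F y (nabN y (X y) Y)"

text \<open>\<open>shape\<close> is \<open>\<S>\<^sub>V w\<close> for \<open>w \<in> range F\<^sub>*\<close> at \<open>F y\<close>. \<open>normal_cov\<close> is the \<open>(range F\<^sub>*)\<^sup>\<bottom>\<close>-component of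
  \<open>\<nabla>\<^sup>B\<^sub>w V\<close> at \<open>F y\<close>, that is, \<open>\<nabla>\<^bsup>F\<bottom>\<^esup>\<^sub>X V\<close> for \<open>w = F\<^sub>*X\<close> and \<open>\<nabla>\<^bsup>F\<bottom>\<^esup>\<^sub>Z V\<close> for \<open>w = Z\<close>.\<close>

definition shape :: "('a, 'e::euclidean_space) mfd \<Rightarrow> ('b, 'f::euclidean_space) mfd \<Rightarrow>
    'b metric \<Rightarrow> 'b conn \<Rightarrow> ('a \<Rightarrow> 'b) \<Rightarrow> 'a \<Rightarrow> ('b \<Rightarrow> 'b tvec) \<Rightarrow> 'b tvec \<Rightarrow> 'b tvec" where
  "shape N B gB nabB F y V w = - orth_proj gB (F y) (rangeF N B F y) (nabB (F y) w V)"

definition normal_cov :: "('a, 'e::euclidean_space) mfd \<Rightarrow> ('b, 'f::euclidean_space) mfd \<Rightarrow>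
    'b metric \<Rightarrow> 'b conn \<Rightarrow> ('a \<Rightarrow> 'b) \<Rightarrow> 'a \<Rightarrow> 'b tvec \<Rightarrow> ('b \<Rightarrow> 'b tvec) \<Rightarrow> 'b tvec" where
  "normal_cov N B gB nabB F y w V =
     orth_proj gB (F y) (perp B gB (F y) (rangeF N B F y)) (nabB (F y) w V)"

end

theory Submission
  imports Defs
begin

text \<open>
  Since \<open>\<sigma> = F \<circ> \<gamma>\<close>, the velocity \<open>\<sigma>' = F\<^sub>*\<gamma>'\<close> lies in the range of \<open>F\<^sub>*\<close>. Hence its normal component
  \<open>Z\<close>, and with it \<open>\<phi>Z = BZ + CZ\<close> and both of these mutually orthogonal summands, vanish along the
  curve. So the fields \<open>BZ\<close> and \<open>CZ\<close> have zero covariant derivative in the direction of \<open>\<sigma>'\<close>, and what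
  remains of the two equations is that \<open>\<nabla>\<^bsub>\<sigma>'\<^esub>(\<phi>\<sigma>')\<close> has tangential component \<open>0\<close> and normal component
  \<open>v\<xi>\<close>, provided that \<open>(\<nabla>F\<^sub>*)(Y\<^sub>1,Y)\<close> and \<open>F\<^sub>*(H\<nabla>\<^bsub>Y\<^sub>1\<^esub>Y)\<close> vanish too. As \<open>\<xi>\<close> is normal, the two conditions
  together say \<open>\<nabla>\<^bsub>\<sigma>'\<^esub>(\<phi>\<sigma>') = v\<xi>\<close>.

  The Sasakian identity for \<open>\<nabla>\<phi>\<close> turns this into \<open>\<phi>(\<nabla>\<^bsub>\<sigma>'\<^esub>\<sigma>') = 0\<close>, that is, \<open>\<nabla>\<^bsub>\<sigma>'\<^esub>\<sigma>'\<close> is a multiple of \<open>\<xi>\<close>; and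
  the multiple is \<open>0\<close> because \<open>\<eta>(\<sigma>') = 0\<close> along the curve and \<open>\<nabla>\<xi> = -\<phi>\<close> is skew
  (\<open>acceleration_eq_0_iff_sasakian\<close>).

  The terms with \<open>Y\<close> need care: \<open>Y\<close> vanishes along \<open>\<gamma>\<close>, but \<open>Y\<^sub>1\<close> is only determined up to vertical
  vectors, so \<open>\<nabla>\<^bsub>Y\<^sub>1\<^esub>Y\<close> is not a derivative along \<open>\<gamma>\<close>. However \<open>\<bar>Y\<bar>\<^sup>2 = \<bar>BZ\<bar>\<^sup>2 \<circ> F\<close>, and at a zero of a field
  half the second derivative of its squared norm is the squared norm of its first derivative.
  Comparing the two sides gives \<open>\<bar>\<nabla>\<^bsub>Y\<^sub>1\<^esub>Y\<bar> = \<bar>\<nabla>\<^bsub>\<sigma>'\<^esub>BZ\<bar> = 0\<close> (\<open>nab_norm_eq_at_zero_of_related_fields\<close>).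

  All covariant derivatives along maps are evaluated by \<open>pullback_cov_eq\<close>, whose content is that the
  pullback connection does not depend on the representation of a section. No local frames enter:
  metric compatibility recovers the pairing of the derivative with any smooth field from the section.
\<close>

section \<open>Functions of class \<open>C\<^sup>k\<close>\<close>

lemma Ck_on_subset: "Ck_on k T f \<Longrightarrow> S \<subseteq> T \<Longrightarrow> Ck_on k S f"
proof (induction k arbitrary: f)
  case 0
  then show ?case by (auto intro: continuous_on_subset)
next
  case (Suc k)
  then obtain f' where "\<forall>x\<in>T. (f has_derivative f' x) (at x)" "\<forall>v. Ck_on k T (\<lambda>x. f' x v)"
    by auto
  with Suc.prems(2) Suc.IH[OF _ Suc.prems(2)] show ?case
    unfolding Ck_on.simps by (intro exI[of _ f']) blast
qed

lemma Ck_on_lower: "Ck_on (Suc k) S f \<Longrightarrow> Ck_on k S f"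
proof (induction k arbitrary: f)
  case 0
  then show ?case
    by (auto intro!: continuous_at_imp_continuous_on dest: has_derivative_continuous)
next
  case (Suc k)
  then obtain f' where "\<forall>x\<in>S. (f has_derivative f' x) (at x)" "\<forall>v. Ck_on (Suc k) S (\<lambda>x. f' x v)"
    by (auto simp del: Ck_on.simps simp add: Ck_on.simps(2)[of "Suc k"])
  then show ?case using Suc.IH by auto
qed

lemma Ck_on_cong:
  assumes "open S" "\<And>x. x \<in> S \<Longrightarrow> f x = g x" "Ck_on k S f"
  shows "Ck_on k S g"
proof (cases k)
  case 0
  then show ?thesis using assms continuous_on_cong[of S S f g] by auto
next
  case (Suc m)
  then obtain f' where f': "\<forall>x\<in>S. (f has_derivative f' x) (at x)" "\<forall>v. Ck_on m S (\<lambda>x. f' x v)"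
    using assms(3) by auto
  have "\<forall>x\<in>S. (g has_derivative f' x) (at x)"
    by (intro ballI has_derivative_transform_within_open[of f _ _ UNIV S g]) (use f'(1) assms in auto)
  then show ?thesis using f'(2) Suc by auto
qed

text \<open>The derivatives provided on the several neighbourhoods agree where they meet, since each is the
  Frechet derivative; this one is used on all of \<open>S\<close>.\<close>

lemma Ck_on_local:
  assumes "\<And>x. x \<in> S \<Longrightarrow> \<exists>T. open T \<and> x \<in> T \<and> Ck_on k T f"
  shows "Ck_on k S f"
  using assms
proof (induction k arbitrary: f)
  case 0
  show ?case
    unfolding Ck_on.simps
  proof (intro continuous_at_imp_continuous_on ballI)
    fix x assume "x \<in> S"
    then show "isCont f x" using 0[of x] continuous_on_eq_continuous_at by auto
  qed
next
  case (Suc k)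
  define f' where "f' = (\<lambda>x. frechet_derivative f (at x))"
  have loc: "\<exists>T. open T \<and> x \<in> T \<and> (f has_derivative f' x) (at x) \<and> (\<forall>v. Ck_on k T (\<lambda>x. f' x v))"
    if "x \<in> S" for x
  proof -
    obtain T g where T: "open T" "x \<in> T" "\<forall>x\<in>T. (f has_derivative g x) (at x)"
        "\<forall>v. Ck_on k T (\<lambda>x. g x v)"
      using Suc.prems[OF \<open>x \<in> S\<close>] by auto
    have "f' y = g y" if "y \<in> T" for y
      using T(3) that frechet_derivative_at unfolding f'_def by metis
    then show ?thesis
      using T Ck_on_cong[of T "\<lambda>x. g x v" "\<lambda>x. f' x v" k for v] by (intro exI[of _ T]) auto
  qed
  have "Ck_on k S (\<lambda>x. f' x v)" for v
    using loc by (intro Suc.IH) blast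
  then show ?case using loc by auto
qed

lemma Ck_on_const: "Ck_on k S (\<lambda>x. c)"
proof (induction k arbitrary: c)
  case (Suc k)
  have "\<forall>x\<in>S. ((\<lambda>x. c) has_derivative (\<lambda>h. 0)) (at x)" by simp
  then show ?case using Suc unfolding Ck_on.simps by (intro exI[of _ "\<lambda>x h. 0"]) simp
qed simp

lemma Ck_on_ident: "Ck_on k S (\<lambda>x. x)"
proof (cases k)
  case (Suc k)
  have "\<forall>x\<in>S. ((\<lambda>x. x) has_derivative (\<lambda>h. h)) (at x)" by simp
  then show ?thesis
    using Suc Ck_on_const unfolding Ck_on.simps by (auto intro!: exI[of _ "\<lambda>x h. h"])
qed simp

lemma Ck_on_add: "Ck_on k S f \<Longrightarrow> Ck_on k S g \<Longrightarrow> Ck_on k S (\<lambda>x. f x + g x)"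
proof (induction k arbitrary: f g)
  case 0
  then show ?case by (auto intro: continuous_on_add)
next
  case (Suc k)
  obtain f' g' where f': "\<forall>x\<in>S. (f has_derivative f' x) (at x)" "\<forall>v. Ck_on k S (\<lambda>x. f' x v)"
    and g': "\<forall>x\<in>S. (g has_derivative g' x) (at x)" "\<forall>v. Ck_on k S (\<lambda>x. g' x v)"
    using Suc.prems by auto
  then have "\<forall>x\<in>S. ((\<lambda>x. f x + g x) has_derivative (\<lambda>v. f' x v + g' x v)) (at x)"
    by (auto intro: has_derivative_add)
  then show ?case using f' g' Suc.IH
    unfolding Ck_on.simps by (intro exI[of _ "\<lambda>x v. f' x v + g' x v"]) auto
qed

lemma Ck_on_sum: "(\<And>i. i \<in> A \<Longrightarrow> Ck_on k S (f i)) \<Longrightarrow> Ck_on k S (\<lambda>x. \<Sum>i\<in>A. f i x)"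
  by (induction A rule: infinite_finite_induct) (auto intro: Ck_on_add Ck_on_const)

lemma Ck_on_bilinear:
  assumes "bounded_bilinear pr"
  shows "Ck_on k S f \<Longrightarrow> Ck_on k S g \<Longrightarrow> Ck_on k S (\<lambda>x. pr (f x) (g x))"
proof (induction k arbitrary: f g)
  case 0
  then show ?case by (auto intro: bounded_bilinear.continuous_on[OF assms])
next
  case (Suc k)
  obtain f' g' where f': "\<forall>x\<in>S. (f has_derivative f' x) (at x)" "\<forall>v. Ck_on k S (\<lambda>x. f' x v)"
    and g': "\<forall>x\<in>S. (g has_derivative g' x) (at x)" "\<forall>v. Ck_on k S (\<lambda>x. g' x v)"
    using Suc.prems by auto
  then have "\<forall>x\<in>S. ((\<lambda>x. pr (f x) (g x)) has_derivative
      (\<lambda>v. pr (f x) (g' x v) + pr (f' x v) (g x))) (at x)"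
    by (auto intro: bounded_bilinear.FDERIV[OF assms])
  moreover have "Ck_on k S (\<lambda>x. pr (f x) (g' x v) + pr (f' x v) (g x))" for v
    using Suc.IH Suc.prems[THEN Ck_on_lower] f' g' by (intro Ck_on_add) auto
  ultimately show ?case
    unfolding Ck_on.simps by (intro exI[of _ "\<lambda>x v. pr (f x) (g' x v) + pr (f' x v) (g x)"]) auto
qed

text \<open>By linearity \<open>D(g \<circ> f) v = \<Sum>b. (Df v \<bullet> b) Dg(f x) b\<close>, so that only the partial derivatives of
  \<open>g\<close>, taken in directions that do not depend on the point, have to be composed with \<open>f\<close>.\<close>

lemma Ck_on_compose:
  fixes f :: "'a::euclidean_space \<Rightarrow> 'b::euclidean_space"
  assumes "f ` S \<subseteq> T"
  shows "Ck_on k S f \<Longrightarrow> Ck_on k T g \<Longrightarrow> Ck_on k S (g \<circ> f)"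
proof (induction k arbitrary: g)
  case 0
  then show ?case using continuous_on_compose2[OF _ _ assms] by (auto simp: o_def)
next
  case (Suc k)
  obtain f' g' where f': "\<forall>x\<in>S. (f has_derivative f' x) (at x)" "\<forall>v. Ck_on k S (\<lambda>x. f' x v)"
    and g': "\<forall>x\<in>T. (g has_derivative g' x) (at x)" "\<forall>v. Ck_on k T (\<lambda>x. g' x v)"
    using Suc.prems by auto
  define h where "h = (\<lambda>x v. \<Sum>b\<in>Basis. (f' x v \<bullet> b) *\<^sub>R g' (f x) b)"
  have "((g \<circ> f) has_derivative h x) (at x)" if "x \<in> S" for x
  proof -
    have g'': "(g has_derivative g' (f x)) (at (f x))" using g' assms that by auto
    interpret bounded_linear "g' (f x)" using g'' by (rule has_derivative_bounded_linear)
    have "h x = g' (f x) \<circ> f' x"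
      by (simp add: h_def fun_eq_iff scaleR[symmetric] sum[symmetric] euclidean_representation)
    then show ?thesis using diff_chain_at[of f "f' x" x g, OF _ g''] f' that by auto
  qed
  moreover have "Ck_on k S (\<lambda>x. h x v)" for v
    unfolding h_def
  proof (intro Ck_on_sum Ck_on_bilinear[OF bounded_bilinear_scaleR])
    fix b :: 'b assume "b \<in> Basis"
    show "Ck_on k S (\<lambda>x. f' x v \<bullet> b)"
      using f' by (intro Ck_on_bilinear[OF bounded_bilinear_inner] Ck_on_const) auto
    show "Ck_on k S (\<lambda>x. g' (f x) b)"
      using Suc.IH[of "\<lambda>z. g' z b"] Ck_on_lower[OF Suc.prems(1)] g' by (simp add: o_def)
  qed
  ultimately show ?case unfolding Ck_on.simps by blast
qed

lemma smooth_on_local: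
  "(\<And>x. x \<in> S \<Longrightarrow> \<exists>T. open T \<and> x \<in> T \<and> smooth_on T f) \<Longrightarrow> smooth_on S f"
  unfolding smooth_on_def by (intro allI Ck_on_local) blast

lemma smooth_on_subset: "smooth_on T f \<Longrightarrow> S \<subseteq> T \<Longrightarrow> smooth_on S f"
  unfolding smooth_on_def using Ck_on_subset by blast

lemma smooth_on_cong:
  "open S \<Longrightarrow> (\<And>x. x \<in> S \<Longrightarrow> f x = g x) \<Longrightarrow> smooth_on S f \<Longrightarrow> smooth_on S g"
  unfolding smooth_on_def using Ck_on_cong[of S f g] by simp

lemma smooth_on_compose:
  "f ` S \<subseteq> T \<Longrightarrow> smooth_on S f \<Longrightarrow> smooth_on T g \<Longrightarrow> smooth_on S (g \<circ> f)"
  unfolding smooth_on_def using Ck_on_compose by blast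

section \<open>Charts and smooth maps\<close>

lemma chart:
  assumes "smooth_manifold M" "(U, c) \<in> atlas M"
  shows chart_open: "openin (mtop M) U" and chart_subset: "U \<subseteq> pts M"
    and chart_inj: "inj_on c U"
    and chart_image_open: "openin (mtop M) W \<Longrightarrow> open (c ` (U \<inter> W))"
proof -
  have U: "openin (mtop M) U" "open (c ` U)"
    "homeomorphic_map (subtopology (mtop M) U) (top_of_set (c ` U)) c"
    using assms unfolding smooth_manifold_def by auto
  then show "openin (mtop M) U" and sub: "U \<subseteq> pts M" using openin_subset by auto
  have top: "topspace (subtopology (mtop M) U) = U" using sub by auto
  show "inj_on c U" using homeomorphic_imp_injective_map[OF U(3)] top by simp
  show "open (c ` (U \<inter> W))" if "openin (mtop M) W"
  proof -
    have "openin (subtopology (mtop M) U) (U \<inter> W)"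
      using that by (auto simp: openin_subtopology)
    then have "openin (top_of_set (c ` U)) (c ` (U \<inter> W))"
      using homeomorphic_map_openness[OF U(3), of "U \<inter> W"] top by auto
    then show ?thesis using U(2) openin_open_eq by blast
  qed
qed

lemma chart_exists:
  assumes "smooth_manifold M" "p \<in> pts M"
  obtains U c where "(U, c) \<in> atlas M" "p \<in> U"
  using assms unfolding smooth_manifold_def by auto

text \<open>Smoothness is local, so near each point \<open>F\<close> can be read in a single target chart and the chain
  rule applies. One argument serves both functions pulled back along \<open>F\<close> (\<open>h\<close> real-valued) and
  composites of smooth maps (\<open>h\<close> a second map read in a chart of its target).\<close>

lemma smooth_on_chart_compose:
  assumes M: "smooth_manifold M" and M': "smooth_manifold M'" and F: "smooth_map M M' F"
    and W: "openin (mtop M') W" and c: "(U, c) \<in> atlas M"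
    and h: "\<And>V d. (V, d) \<in> atlas M' \<Longrightarrow> smooth_on (d ` (V \<inter> W)) (h \<circ> inv_into V d)"
    and S: "S \<subseteq> U" "F ` S \<subseteq> W"
  shows "smooth_on (c ` S) (h \<circ> F \<circ> inv_into U c)"
proof (rule smooth_on_local)
  fix x assume "x \<in> c ` S"
  then obtain u where u: "x = c u" "u \<in> S" by auto
  have Fcont: "continuous_map (mtop M) (mtop M') F" using F unfolding smooth_map_def by auto
  have "F u \<in> pts M'"
    using u S W openin_subset by blast
  then obtain V d where d: "(V, d) \<in> atlas M'" "F u \<in> V" using chart_exists[OF M'] by blast
  define O' where "O' = {q \<in> pts M. F q \<in> V \<inter> W}"
  have O': "openin (mtop M) O'"
    unfolding O'_def using Fcont chart_open[OF M' d(1)] W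
    by (intro openin_continuous_map_preimage[OF Fcont]) auto
  define T where "T = c ` (U \<inter> O')"
  have T: "open T" unfolding T_def by (rule chart_image_open[OF M c O'])
  have inv: "inv_into U c (c q) = q" if "q \<in> U" for q using chart_inj[OF M c] that by auto
  have "smooth_on T (d \<circ> F \<circ> inv_into U c)"
    by (rule smooth_on_subset[of "c ` (U \<inter> F -` V)"])
       (use F c d in \<open>auto simp: smooth_map_def T_def O'_def\<close>)
  moreover have "(d \<circ> F \<circ> inv_into U c) ` T \<subseteq> d ` (V \<inter> W)"
    by (auto simp: T_def O'_def inv)
  ultimately have "smooth_on T ((h \<circ> inv_into V d) \<circ> (d \<circ> F \<circ> inv_into U c))"
    using h[OF d(1)] by (intro smooth_on_compose)
  then have "smooth_on T (h \<circ> F \<circ> inv_into U c)"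
    by (rule smooth_on_cong[OF T, rotated])
       (auto simp: T_def O'_def inv chart_inj[OF M' d(1)])
  moreover have "x \<in> T" using u S d chart_subset[OF M c] by (auto simp: T_def O'_def)
  ultimately show "\<exists>T. open T \<and> x \<in> T \<and> smooth_on T (h \<circ> F \<circ> inv_into U c)" using T by blast
qed

lemma smooth_map_pts: "smooth_map M M' F \<Longrightarrow> p \<in> pts M \<Longrightarrow> F p \<in> pts M'"
  unfolding smooth_map_def by (auto simp: continuous_map_def)

lemma smooth_map_compose:
  assumes "smooth_manifold M" "smooth_manifold M'" "smooth_manifold M''"
    and F: "smooth_map M M' F" and G: "smooth_map M' M'' G"
  shows "smooth_map M M'' (G \<circ> F)"
  unfolding smooth_map_def
proof (intro conjI ballI, safe)
  have cont: "continuous_map (mtop M) (mtop M') F" "continuous_map (mtop M') (mtop M'') G"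
    using F G unfolding smooth_map_def by auto
  then show "continuous_map (mtop M) (mtop M'') (G \<circ> F)" by (rule continuous_map_compose)
  fix U c V d assume c: "(U, c) \<in> atlas M" and d: "(V, d) \<in> atlas M''"
  define W where "W = {q \<in> pts M'. G q \<in> V}"
  have "smooth_on (c ` (U \<inter> (G \<circ> F) -` V)) ((d \<circ> G) \<circ> F \<circ> inv_into U c)"
  proof (rule smooth_on_chart_compose[OF assms(1,2) F _ c])
    show "openin (mtop M') W" unfolding W_def
      using openin_continuous_map_preimage[OF cont(2) chart_open[OF assms(3) d]] by simp
    show "smooth_on (e ` (X \<inter> W)) (d \<circ> G \<circ> inv_into X e)" if "(X, e) \<in> atlas M'" for X e
      by (rule smooth_on_subset[of "e ` (X \<inter> G -` V)"])
         (use G d that in \<open>auto simp: smooth_map_def W_def\<close>)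
    show "F ` (U \<inter> (G \<circ> F) -` V) \<subseteq> W"
      using cont(1) chart_subset[OF assms(1) c] by (auto simp: W_def continuous_map_def)
  qed auto
  then show "smooth_on (c ` (U \<inter> (G \<circ> F) -` V)) (d \<circ> (G \<circ> F) \<circ> inv_into U c)"
    by (simp add: o_assoc)
qed

lemma smooth_manifold_interval:
  assumes "open I"
  shows "smooth_manifold (interval_mfd I)"
proof -
  obtain Bs :: "real set set" where Bs: "countable Bs" "topological_basis Bs"
    using ex_countable_basis by blast
  have "\<exists>V\<in>Bs. x \<in> V \<and> V \<subseteq> U" if "open U" "x \<in> U" for U x
    by (rule topological_basisE[OF Bs(2) that]) blast
  then have "second_countable (euclidean :: real topology)"
    unfolding second_countable_def using Bs(1) topological_basis_open[OF Bs(2)]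
    by (intro exI[of _ Bs]) simp
  then have "second_countable (top_of_set I)" by (rule second_countable_subtopology)
  moreover have "Hausdorff_space (top_of_set I)"
    by (simp add: Hausdorff_space_subtopology)
  moreover have "homeomorphic_map (top_of_set I) (top_of_set I) (\<lambda>t. t)"
    using homeomorphic_map_id[of "top_of_set I" "top_of_set I"] by (simp add: id_def)
  moreover have "smooth_on I ((\<lambda>t. t) \<circ> inv_into I (\<lambda>t. t))"
  proof (rule smooth_on_cong[OF assms])
    show "smooth_on I (\<lambda>t. t)" by (simp add: smooth_on_def Ck_on_ident)
    show "t = ((\<lambda>t. t) \<circ> inv_into I (\<lambda>t. t)) t" if "t \<in> I" for t
      using inv_into_f_f[of "\<lambda>t. t" I t] that by simp
  qed
  ultimately show ?thesis
    using assms by (simp add: smooth_manifold_def interval_mfd_def subtopology_subtopology)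
qed

lemma pts_interval [simp]: "pts (interval_mfd I) = I"
  by (simp add: interval_mfd_def)

section \<open>Smooth functions and germs\<close>

lemma smooth_fun_on_subset:
  "smooth_fun_on M W f \<Longrightarrow> openin (mtop M) V \<Longrightarrow> V \<subseteq> W \<Longrightarrow> smooth_fun_on M V f"
  unfolding smooth_fun_on_def by (fast intro: smooth_on_subset)

lemma smooth_fun_on_cong:
  assumes M: "smooth_manifold M" and f: "smooth_fun_on M W f" and "\<And>q. q \<in> W \<Longrightarrow> f q = g q"
  shows "smooth_fun_on M W g"
  unfolding smooth_fun_on_def
proof (intro conjI ballI, safe)
  show W: "openin (mtop M) W" using f unfolding smooth_fun_on_def by auto
  fix U c assume c: "(U, c) \<in> atlas M"
  show "smooth_on (c ` (U \<inter> W)) (g \<circ> inv_into U c)"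
    by (rule smooth_on_cong[OF chart_image_open[OF M c W], of "f \<circ> inv_into U c"])
       (use f c assms(3) chart_inj[OF M c] in \<open>auto simp: smooth_fun_on_def\<close>)
qed

lemma smooth_fun_on_const: "openin (mtop M) W \<Longrightarrow> smooth_fun_on M W (\<lambda>q. a)"
  unfolding smooth_fun_on_def smooth_on_def by (auto simp: o_def Ck_on_const)

lemma smooth_fun_on_add:
  "smooth_fun_on M W f \<Longrightarrow> smooth_fun_on M W h \<Longrightarrow> smooth_fun_on M W (\<lambda>q. f q + h q)"
  unfolding smooth_fun_on_def smooth_on_def o_def by (fast intro: Ck_on_add)

lemma smooth_fun_on_mult:
  "smooth_fun_on M W f \<Longrightarrow> smooth_fun_on M W h \<Longrightarrow> smooth_fun_on M W (\<lambda>q. f q * h q)"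
  unfolding smooth_fun_on_def smooth_on_def o_def
  by (fast intro: Ck_on_bilinear[OF bounded_bilinear_mult])

lemma smooth_fun_on_compose:
  assumes M: "smooth_manifold M" "smooth_manifold M'" and F: "smooth_map M M' F"
    and f: "smooth_fun_on M' W f"
  shows "smooth_fun_on M {q \<in> pts M. F q \<in> W} (f \<circ> F)"
  unfolding smooth_fun_on_def
proof (intro conjI ballI, safe)
  have W: "openin (mtop M') W" using f unfolding smooth_fun_on_def by auto
  show "openin (mtop M) {q \<in> pts M. F q \<in> W}"
    using F W unfolding smooth_map_def by (auto intro: openin_continuous_map_preimage)
  fix U c assume c: "(U, c) \<in> atlas M"
  show "smooth_on (c ` (U \<inter> {q \<in> pts M. F q \<in> W})) (f \<circ> F \<circ> inv_into U c)"
    by (rule smooth_on_chart_compose[OF M F W c])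
       (use f in \<open>auto simp: smooth_fun_on_def\<close>)
qed

text \<open>Germs: the neighbourhood filter keeps track of the finitely many open sets to intersect.\<close>

abbreviation near :: "('a, 'e) mfd \<Rightarrow> 'a \<Rightarrow> 'a filter" where
  "near M p \<equiv> nhdsin (mtop M) p"

lemma eventually_near:
  "p \<in> pts M \<Longrightarrow> eventually P (near M p) \<longleftrightarrow> (\<exists>S. openin (mtop M) S \<and> p \<in> S \<and> (\<forall>q\<in>S. P q))"
  by (simp add: eventually_nhdsin)

lemma eventually_nearI:
  "openin (mtop M) S \<Longrightarrow> p \<in> S \<Longrightarrow> (\<And>q. q \<in> S \<Longrightarrow> P q) \<Longrightarrow> eventually P (near M p)"
  by (auto simp: eventually_nhdsin)

lemma eventually_near_self: "eventually P (near M p) \<Longrightarrow> p \<in> pts M \<Longrightarrow> P p"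
  by (auto simp: eventually_nhdsin)

lemma eventually_near_compose:
  assumes "smooth_map M M' F" "p \<in> pts M" "eventually P (near M' (F p))"
  shows "eventually (\<lambda>q. P (F q)) (near M p)"
proof -
  have F: "continuous_map (mtop M) (mtop M') F" using assms(1) unfolding smooth_map_def by auto
  then have "F p \<in> pts M'" using assms(2) by (auto simp: continuous_map_def)
  then obtain S where S: "openin (mtop M') S" "F p \<in> S" "\<forall>q\<in>S. P q"
    using assms(3) by (auto simp: eventually_near)
  then have "openin (mtop M) {q \<in> pts M. F q \<in> S}"
    using F by (auto intro: openin_continuous_map_preimage)
  then show ?thesis using S assms(2) by (auto intro!: eventually_nearI)
qed

lemma near_intervalI:
  assumes "t \<in> I" "\<forall>\<^sub>F s in nhds t. P s"
  shows "\<forall>\<^sub>F s in near (interval_mfd I) t. P s"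
proof -
  obtain S where S: "open S" "t \<in> S" "\<forall>s\<in>S. P s" using assms(2) unfolding eventually_nhds by auto
  then have "openin (mtop (interval_mfd I)) (I \<inter> S)" by (auto simp: interval_mfd_def openin_open)
  then show ?thesis by (rule eventually_nearI) (use S assms(1) in auto)
qed

lemma smooth_fun_atE:
  assumes "smooth_fun_at M p f"
  obtains W where "openin (mtop M) W" "p \<in> W" "smooth_fun_on M W f"
  using assms unfolding smooth_fun_at_def smooth_fun_on_def by auto

lemma smooth_fun_at_pts: "smooth_fun_at M p f \<Longrightarrow> p \<in> pts M"
  by (auto elim!: smooth_fun_atE dest: openin_subset)

lemma smooth_fun_at_const: "p \<in> pts M \<Longrightarrow> smooth_fun_at M p (\<lambda>q. a)"
  unfolding smooth_fun_at_def using smooth_fun_on_const by blast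

lemma smooth_fun_at_common:
  assumes "smooth_fun_at M p f" "smooth_fun_at M p h"
  obtains W where "p \<in> W" "smooth_fun_on M W f" "smooth_fun_on M W h"
proof -
  obtain V W where "openin (mtop M) V" "p \<in> V" "smooth_fun_on M V f"
      "openin (mtop M) W" "p \<in> W" "smooth_fun_on M W h"
    using assms by (elim smooth_fun_atE)
  then show thesis
    using smooth_fun_on_subset[of M V f "V \<inter> W"] smooth_fun_on_subset[of M W h "V \<inter> W"]
    by (intro that[of "V \<inter> W"]) auto
qed

lemma smooth_fun_at_add:
  "smooth_fun_at M p f \<Longrightarrow> smooth_fun_at M p h \<Longrightarrow> smooth_fun_at M p (\<lambda>q. f q + h q)"
  by (erule (1) smooth_fun_at_common) (auto simp: smooth_fun_at_def intro: smooth_fun_on_add)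

lemma smooth_fun_at_mult:
  "smooth_fun_at M p f \<Longrightarrow> smooth_fun_at M p h \<Longrightarrow> smooth_fun_at M p (\<lambda>q. f q * h q)"
  by (erule (1) smooth_fun_at_common) (auto simp: smooth_fun_at_def intro: smooth_fun_on_mult)

lemma smooth_fun_at_sum:
  assumes "\<And>i. i < k \<Longrightarrow> smooth_fun_at M p (f i)" "p \<in> pts M"
  shows "smooth_fun_at M p (\<lambda>q. \<Sum>i<(k::nat). f i q)"
  using assms by (induction k) (auto intro: smooth_fun_at_const smooth_fun_at_add)

lemma smooth_fun_at_cong:
  assumes M: "smooth_manifold M" and f: "smooth_fun_at M p f" and "\<forall>\<^sub>F q in near M p. f q = g q"
  shows "smooth_fun_at M p g"
proof -
  obtain W where W: "openin (mtop M) W" "p \<in> W" "smooth_fun_on M W f" using f by (rule smooth_fun_atE)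
  obtain S where S: "openin (mtop M) S" "p \<in> S" "\<forall>q\<in>S. f q = g q"
    using assms(3) smooth_fun_at_pts[OF f] by (auto simp: eventually_near)
  have "smooth_fun_on M (W \<inter> S) f"
    using W S by (intro smooth_fun_on_subset[OF W(3)]) auto
  then have "smooth_fun_on M (W \<inter> S) g"
    by (rule smooth_fun_on_cong[OF M]) (use S in blast)
  then show ?thesis unfolding smooth_fun_at_def using W(2) S(2) by blast
qed

lemma smooth_fun_at_compose:
  assumes "smooth_manifold M" "smooth_manifold M'" "smooth_map M M' F"
    and "smooth_fun_at M' (F p) f" "p \<in> pts M"
  shows "smooth_fun_at M p (f \<circ> F)"
proof -
  obtain W where W: "F p \<in> W" "smooth_fun_on M' W f"
    using assms(4) unfolding smooth_fun_at_def by auto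
  show ?thesis
    unfolding smooth_fun_at_def
    by (rule exI[of _ "{q \<in> pts M. F q \<in> W}"])
       (use W smooth_fun_on_compose[OF assms(1-3) W(2)] assms(5) in simp)
qed

section \<open>Tangent vectors\<close>

lemma subspace_tangent_space: "subspace (tangent_space M p)"
  unfolding subspace_def tangent_space_def
  by (auto simp: zero_fun_def plus_fun_def scaleR_fun_def algebra_simps)

lemma zero_tangent [simp]: "0 \<in> tangent_space M p"
  using subspace_tangent_space by (rule subspace_0)

lemma tangent_add:
  "v \<in> tangent_space M p \<Longrightarrow> smooth_fun_at M p f \<Longrightarrow> smooth_fun_at M p h \<Longrightarrow>
    v (\<lambda>q. f q + h q) = v f + v h"
  and tangent_mult:
  "v \<in> tangent_space M p \<Longrightarrow> smooth_fun_at M p f \<Longrightarrow> smooth_fun_at M p h \<Longrightarrow>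
    v (\<lambda>q. f q * h q) = v f * h p + f p * v h"
  and tangent_scale:
  "v \<in> tangent_space M p \<Longrightarrow> smooth_fun_at M p f \<Longrightarrow> v (\<lambda>q. a * f q) = a * v f"
  and tangent_nonsmooth:
  "v \<in> tangent_space M p \<Longrightarrow> \<not> smooth_fun_at M p f \<Longrightarrow> v f = 0"
  unfolding tangent_space_def by auto

lemma tangent_const:
  assumes "v \<in> tangent_space M p" "p \<in> pts M"
  shows "v (\<lambda>q. a) = 0"
proof -
  have s: "smooth_fun_at M p (\<lambda>q. b)" for b by (rule smooth_fun_at_const[OF assms(2)])
  have "v (\<lambda>q. 1) = 0" using tangent_mult[OF assms(1) s[of 1] s[of 1]] by simp
  then show ?thesis using tangent_scale[OF assms(1) s[of 1], of a] by simp
qed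

text \<open>Multiplication by the indicator function of a small open set \<open>S\<close>, which is smooth at \<open>p\<close> and
  killed by \<open>v\<close> because it is \<open>1\<close> near \<open>p\<close>, makes two functions with the same germ equal.\<close>

lemma tangent_germ:
  assumes M: "smooth_manifold M" and v: "v \<in> tangent_space M p" and p: "p \<in> pts M"
    and ev: "\<forall>\<^sub>F q in near M p. f q = g q"
  shows "v f = v g"
proof -
  obtain S where S: "openin (mtop M) S" "p \<in> S" "\<forall>q\<in>S. f q = g q"
    using ev p by (auto simp: eventually_near)
  define e :: "_ \<Rightarrow> real" where "e = (\<lambda>q. if q \<in> S then 1 else 0)"
  have e1: "\<forall>\<^sub>F q in near M p. 1 = e q" using S by (intro eventually_nearI) (auto simp: e_def)
  have e: "smooth_fun_at M p e"
    by (rule smooth_fun_at_cong[OF M smooth_fun_at_const[OF p] e1])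
  have "v (\<lambda>q. e q * e q) = 2 * v e" using tangent_mult[OF v e e] S by (simp add: e_def)
  moreover have "(\<lambda>q. e q * e q) = e" by (auto simp: e_def)
  ultimately have "v e = 0" by simp
  then have *: "v (\<lambda>q. e q * h q) = v h" if "smooth_fun_at M p h" for h
    using tangent_mult[OF v e that] S by (simp add: e_def)
  show ?thesis
  proof (cases "smooth_fun_at M p f")
    case True
    then have "smooth_fun_at M p g" using smooth_fun_at_cong[OF M _ ev] by blast
    moreover have "(\<lambda>q. e q * f q) = (\<lambda>q. e q * g q)" using S by (auto simp: e_def)
    ultimately show ?thesis using * True by metis
  next
    case False
    have "\<forall>\<^sub>F q in near M p. g q = f q" using ev by (simp add: eq_commute)
    then have "\<not> smooth_fun_at M p g" using smooth_fun_at_cong[OF M] False by blast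
    then show ?thesis using False tangent_nonsmooth[OF v] by simp
  qed
qed

lemma tangent_vanish:
  assumes "smooth_manifold M" "v \<in> tangent_space M p" "p \<in> pts M" "\<forall>\<^sub>F q in near M p. f q = 0"
  shows "v f = 0"
  using tangent_germ[OF assms] tangent_const[OF assms(2,3)] by simp

lemma tangent_sum:
  assumes v: "v \<in> tangent_space M p" and p: "p \<in> pts M"
    and "\<And>i. i < k \<Longrightarrow> smooth_fun_at M p (f i)"
  shows "v (\<lambda>q. \<Sum>i<(k::nat). f i q) = (\<Sum>i<k. v (f i))"
  using assms(3)
proof (induction k)
  case 0
  then show ?case using tangent_const[OF v p] by simp
next
  case (Suc k)
  then show ?case using smooth_fun_at_sum[of k M p f] tangent_add[OF v] p by simp
qed

lemma linear_push: "linear (push M' F p)"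
  by (rule linearI) (auto simp: push_def fun_eq_iff plus_fun_def scaleR_fun_def)

lemma push_apply: "smooth_fun_at M' (F p) f \<Longrightarrow> push M' F p v f = v (f \<circ> F)"
  by (simp add: push_def)

lemma push_tangent:
  assumes M: "smooth_manifold M" "smooth_manifold M'" and F: "smooth_map M M' F"
    and v: "v \<in> tangent_space M p" and p: "p \<in> pts M"
  shows "push M' F p v \<in> tangent_space M' (F p)"
proof -
  note comp = smooth_fun_at_compose[OF M F _ p]
  have "push M' F p v (\<lambda>q. f q + h q) = push M' F p v f + push M' F p v h"
       "push M' F p v (\<lambda>q. f q * h q) = push M' F p v f * h (F p) + f (F p) * push M' F p v h"
    if "smooth_fun_at M' (F p) f" "smooth_fun_at M' (F p) h" for f h
    using that tangent_add[OF v comp[of f] comp[of h]] tangent_mult[OF v comp[of f] comp[of h]]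
    by (simp_all add: push_apply smooth_fun_at_add smooth_fun_at_mult o_def)
  moreover have "push M' F p v (\<lambda>q. a * f q) = a * push M' F p v f"
    if "smooth_fun_at M' (F p) f" for a f
    using that tangent_scale[OF v comp[of f]] smooth_fun_at_pts[OF that]
    by (simp add: push_apply smooth_fun_at_mult smooth_fun_at_const o_def)
  moreover have "push M' F p v f = 0" if "\<not> smooth_fun_at M' (F p) f" for f
    using that by (simp add: push_def)
  ultimately show ?thesis unfolding tangent_space_def by blast
qed

lemma push_compose:
  assumes M: "smooth_manifold M" "smooth_manifold M'" and F: "smooth_map M M' F" and p: "G t \<in> pts M"
  shows "push M' (F \<circ> G) t v = push M' F (G t) (push M G t v)"
  using smooth_fun_at_compose[OF M F _ p] by (auto simp: push_def fun_eq_iff o_assoc)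

lemma ddt_tangent:
  assumes I: "open I" and t: "t \<in> I"
  shows "ddt I t \<in> tangent_space (interval_mfd I) t"
proof -
  let ?M = "interval_mfd I"
  have pts: "t \<in> pts ?M" using t by (simp add: interval_mfd_def)
  have diff: "f differentiable (at t)" if f: "smooth_fun_at ?M t f" for f
  proof -
    obtain W where W: "openin (top_of_set I) W" "t \<in> W" "smooth_fun_on ?M W f"
      using f by (auto elim!: smooth_fun_atE simp: interval_mfd_def)
    have IW: "I \<inter> W = W" using W openin_subset[OF W(1)] by auto
    have "open W" using W I openin_open_eq by blast
    have "Ck_on (Suc 0) W (f \<circ> inv_into I (\<lambda>t. t))"
      using W(3) IW unfolding smooth_fun_on_def smooth_on_def by (simp add: interval_mfd_def del: Ck_on.simps)
    then have "Ck_on (Suc 0) W f"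
    proof (rule Ck_on_cong[OF \<open>open W\<close>, rotated])
      show "(f \<circ> inv_into I (\<lambda>t. t)) x = f x" if "x \<in> W" for x
      proof -
        have "x \<in> I" using IW that by blast
        then show ?thesis using inv_into_f_f[of "\<lambda>t. t" I x] by simp
      qed
    qed
    then show ?thesis using W(2) by (auto simp: differentiable_def)
  qed
  have D: "(f has_real_derivative deriv f t) (at t)" if "smooth_fun_at ?M t f" for f
    using diff[OF that] by (simp add: DERIV_deriv_iff_real_differentiable)
  have "deriv (\<lambda>q. f q + h q) t = deriv f t + deriv h t"
       "deriv (\<lambda>q. f q * h q) t = deriv f t * h t + f t * deriv h t"
    if "smooth_fun_at ?M t f" "smooth_fun_at ?M t h" for f h
    using D[OF that(1)] D[OF that(2)]
    by (auto intro!: DERIV_imp_deriv derivative_eq_intros)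
  moreover have "deriv (\<lambda>q. a * f q) t = a * deriv f t" if "smooth_fun_at ?M t f" for a f
    using D[OF that] by (auto intro!: DERIV_imp_deriv derivative_eq_intros)
  ultimately show ?thesis
    by (simp add: tangent_space_def ddt_def smooth_fun_at_add smooth_fun_at_mult
        smooth_fun_at_const t)
qed

section \<open>Vector fields\<close>

lemma smooth_field_on_open: "smooth_field_on M W X \<Longrightarrow> openin (mtop M) W"
  and smooth_field_on_tangent: "smooth_field_on M W X \<Longrightarrow> p \<in> W \<Longrightarrow> X p \<in> tangent_space M p"
  and smooth_field_on_apply:
    "smooth_field_on M W X \<Longrightarrow> V \<subseteq> W \<Longrightarrow> smooth_fun_on M V f \<Longrightarrow> smooth_fun_on M V (\<lambda>p. X p f)"
  unfolding smooth_field_on_def by auto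

lemma smooth_field_on_subset:
  "smooth_field_on M W X \<Longrightarrow> openin (mtop M) V \<Longrightarrow> V \<subseteq> W \<Longrightarrow> smooth_field_on M V X"
  unfolding smooth_field_on_def by (meson subset_iff)

lemma smooth_field_on_add:
  assumes "smooth_field_on M W X" "smooth_field_on M W Y"
  shows "smooth_field_on M W (\<lambda>q. X q + Y q)"
  unfolding smooth_field_on_def
proof (intro conjI ballI allI impI)
  show "openin (mtop M) W" using assms(1) by (rule smooth_field_on_open)
  show "X p + Y p \<in> tangent_space M p" if "p \<in> W" for p
    using assms that by (simp add: smooth_field_on_tangent subspace_add subspace_tangent_space)
  show "smooth_fun_on M V (\<lambda>p. (X p + Y p) f)" if "V \<subseteq> W" "smooth_fun_on M V f" for V f
    using smooth_fun_on_add assms[THEN smooth_field_on_apply, OF that] by (simp add: plus_fun_def)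
qed

lemma smooth_field_on_scale:
  assumes "smooth_field_on M W X"
  shows "smooth_field_on M W (\<lambda>q. a *\<^sub>R X q)"
  unfolding smooth_field_on_def
proof (intro conjI ballI allI impI)
  show "openin (mtop M) W" using assms(1) by (rule smooth_field_on_open)
  show "a *\<^sub>R X p \<in> tangent_space M p" if "p \<in> W" for p
    using assms that by (simp add: smooth_field_on_tangent subspace_scale subspace_tangent_space)
  show "smooth_fun_on M V (\<lambda>p. (a *\<^sub>R X p) f)" if "V \<subseteq> W" "smooth_fun_on M V f" for V f
  proof -
    have "openin (mtop M) V" using that(2) unfolding smooth_fun_on_def by auto
    then have "smooth_fun_on M V (\<lambda>p. a * X p f)"
      by (rule smooth_fun_on_mult[OF smooth_fun_on_const])
         (rule smooth_field_on_apply[OF assms that])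
    then show ?thesis by (simp add: scaleR_fun_def)
  qed
qed

lemma smooth_field_on_zero:
  assumes "openin (mtop M) W"
  shows "smooth_field_on M W (\<lambda>q. 0)"
  unfolding smooth_field_on_def
proof (intro conjI ballI allI impI)
  show "smooth_fun_on M V (\<lambda>p. 0 f)" if "smooth_fun_on M V f" for V f
    using that smooth_fun_on_const[of M V 0] by (simp add: smooth_fun_on_def)
qed (use assms in \<open>simp_all del: zero_fun_apply\<close>)

lemma smooth_field_atE:
  assumes "smooth_field_at M p X"
  obtains W where "openin (mtop M) W" "p \<in> W" "smooth_field_on M W X"
  using assms smooth_field_on_open unfolding smooth_field_at_def by blast

lemma smooth_field_at_pts: "smooth_field_at M p X \<Longrightarrow> p \<in> pts M"
  by (auto elim!: smooth_field_atE dest: openin_subset)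

lemma smooth_field_at_near:
  "smooth_field_at M p X \<Longrightarrow> \<forall>\<^sub>F q in near M p. X q \<in> tangent_space M q"
  by (erule smooth_field_atE) (auto intro: eventually_nearI dest: smooth_field_on_tangent)

lemma smooth_field_at_tangent: "smooth_field_at M p X \<Longrightarrow> X p \<in> tangent_space M p"
  by (auto elim!: smooth_field_atE dest: smooth_field_on_tangent)

lemma smooth_field_at_common:
  assumes "smooth_field_at M p X" "smooth_field_at M p Y"
  obtains W where "p \<in> W" "smooth_field_on M W X" "smooth_field_on M W Y"
proof -
  obtain V W where "openin (mtop M) V" "p \<in> V" "smooth_field_on M V X"
      "openin (mtop M) W" "p \<in> W" "smooth_field_on M W Y"
    using assms by (elim smooth_field_atE)
  then show thesis
    using smooth_field_on_subset[of M V X "V \<inter> W"] smooth_field_on_subset[of M W Y "V \<inter> W"]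
    by (intro that[of "V \<inter> W"]) auto
qed

lemma smooth_field_at_add:
  assumes "smooth_field_at M p X" "smooth_field_at M p Y"
  shows "smooth_field_at M p (\<lambda>q. X q + Y q)"
proof -
  obtain W where "p \<in> W" "smooth_field_on M W X" "smooth_field_on M W Y"
    using smooth_field_at_common[OF assms] .
  then show ?thesis
    unfolding smooth_field_at_def using smooth_field_on_add[of M W X Y] by blast
qed

lemma smooth_field_at_scale: "smooth_field_at M p X \<Longrightarrow> smooth_field_at M p (\<lambda>q. a *\<^sub>R X q)"
  unfolding smooth_field_at_def using smooth_field_on_scale[of M _ X a] by blast

lemma smooth_field_at_zero: "p \<in> pts M \<Longrightarrow> smooth_field_at M p (\<lambda>q. 0)"
  unfolding smooth_field_at_def by (rule exI[of _ "pts M"]) (simp add: smooth_field_on_zero)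

lemma smooth_field_at_sum:
  "p \<in> pts M \<Longrightarrow> (\<And>i. i < k \<Longrightarrow> smooth_field_at M p (X i)) \<Longrightarrow>
    smooth_field_at M p (\<lambda>q. \<Sum>i<(k::nat). X i q)"
proof (induction k)
  case 0
  then show ?case by (simp add: smooth_field_at_zero del: zero_fun_apply)
next
  case (Suc k)
  then show ?case
    using smooth_field_at_add[of M p "\<lambda>q. \<Sum>i<k. X i q" "X k"] by (simp del: plus_fun_apply)
qed

lemma smooth_field_on_imp_at: "smooth_field_on M W X \<Longrightarrow> p \<in> W \<Longrightarrow> smooth_field_at M p X"
  unfolding smooth_field_at_def by blast

section \<open>Riemannian metrics\<close>

locale riemannian =
  fixes M :: "('a, 'e::euclidean_space) mfd" and g :: "'a metric" and nab :: "'a conn"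
  assumes riemannian: "riemannian_manifold M g nab"
begin

abbreviation T :: "'a \<Rightarrow> 'a tvec set" where "T p \<equiv> tangent_space M p"

lemma manifold: "smooth_manifold M"
  using riemannian unfolding riemannian_manifold_def by auto

context
  fixes p assumes p: "p \<in> pts M"
begin

lemma g_sym: "u \<in> T p \<Longrightarrow> v \<in> T p \<Longrightarrow> g p u v = g p v u"
  and g_pos: "u \<in> T p \<Longrightarrow> u \<noteq> 0 \<Longrightarrow> g p u u > 0"
  and g_add_left: "u \<in> T p \<Longrightarrow> v \<in> T p \<Longrightarrow> w \<in> T p \<Longrightarrow> g p (u + v) w = g p u w + g p v w"
  and g_scale_left: "u \<in> T p \<Longrightarrow> v \<in> T p \<Longrightarrow> g p (a *\<^sub>R u) v = a * g p u v"
  using riemannian p unfolding riemannian_manifold_def riemannian_metric_def by blast+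

lemma g_zero_left: "v \<in> T p \<Longrightarrow> g p 0 v = 0"
  using g_scale_left[of 0 v 0] by (simp del: zero_fun_apply)

lemma g_zero_right: "v \<in> T p \<Longrightarrow> g p v 0 = 0"
  using g_zero_left g_sym[of v 0] by (simp del: zero_fun_apply)

lemma g_add_right: "u \<in> T p \<Longrightarrow> v \<in> T p \<Longrightarrow> w \<in> T p \<Longrightarrow> g p u (v + w) = g p u v + g p u w"
  using g_add_left[of v w u] g_sym subspace_add[OF subspace_tangent_space] by metis

lemma g_scale_right: "u \<in> T p \<Longrightarrow> v \<in> T p \<Longrightarrow> g p u (a *\<^sub>R v) = a * g p u v"
  using g_scale_left[of v u a] g_sym subspace_scale[OF subspace_tangent_space] by metis

lemma g_diff_left: "u \<in> T p \<Longrightarrow> v \<in> T p \<Longrightarrow> w \<in> T p \<Longrightarrow> g p (u - v) w = g p u w - g p v w"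
  using g_add_left[of "u - v" v w] subspace_diff[OF subspace_tangent_space, of u M p v] by simp

lemma g_minus_right: "u \<in> T p \<Longrightarrow> v \<in> T p \<Longrightarrow> g p u (- v) = - g p u v"
  using g_scale_right[of u v "- 1"] by simp

lemma g_eq_0: "u \<in> T p \<Longrightarrow> g p u u = 0 \<Longrightarrow> u = 0"
  using g_pos[of u] by force

lemma g_sum_left:
  assumes "w \<in> T p" "\<And>i. i < k \<Longrightarrow> u i \<in> T p"
  shows "g p (\<Sum>i<(k::nat). u i) w = (\<Sum>i<k. g p (u i) w)"
  using assms
proof (induction k)
  case (Suc k)
  then show ?case
    using g_add_left[of "\<Sum>i<k. u i" "u k" w] subspace_sum[OF subspace_tangent_space, of "{..<k}" u M p]
    by (simp del: plus_fun_apply)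
qed (simp add: g_zero_left del: zero_fun_apply)

lemma perp_disjoint:
  assumes "u \<in> perp M g p S" "u \<in> S"
  shows "u = 0"
  using assms by (intro g_eq_0) (auto simp: perp_def)

lemma subspace_perp:
  assumes "S \<subseteq> T p"
  shows "subspace (perp M g p S)"
  unfolding perp_def
  using assms subspace_add[OF subspace_tangent_space] subspace_scale[OF subspace_tangent_space]
  by (auto simp: subspace_def subset_iff g_zero_left g_add_left g_scale_left)

text \<open>Gram--Schmidt: each new vector is first made orthogonal to the span of the earlier ones. If it
  already lies in that span, the quotient below is \<open>0 / 0 = 0\<close> and nothing changes.\<close>

lemma orth_proj_span_exists:
  assumes "finite b"
  shows "b \<subseteq> T p \<Longrightarrow> v \<in> T p \<Longrightarrow> \<exists>w\<in>span b. \<forall>u\<in>span b. g p (v - w) u = 0"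
  using assms
proof (induction b arbitrary: v)
  case empty
  then show ?case by (simp add: g_zero_right del: zero_fun_apply)
next
  case (insert a b)
  note sub = subspace_tangent_space[of M p]
  have span_T: "span b \<subseteq> T p" using insert.prems span_minimal[OF _ sub] by auto
  have a: "a \<in> T p" and b: "b \<subseteq> T p" using insert.prems by auto
  obtain a0 where a0: "a0 \<in> span b" "\<forall>u\<in>span b. g p (a - a0) u = 0" using insert.IH[OF b a] by blast
  obtain w where w: "w \<in> span b" "\<forall>u\<in>span b. g p (v - w) u = 0" using insert.IH[OF b insert.prems(2)] by blast
  define a' where "a' = a - a0"
  have T: "a0 \<in> T p" "w \<in> T p" "a' \<in> T p" "v - w \<in> T p"
    using a0 w span_T a insert.prems by (auto simp: a'_def intro: subspace_diff[OF sub])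
  define c where "c = g p (v - w) a' / g p a' a'"
  have c: "c * g p a' a' = g p (v - w) a'"
    using g_eq_0[OF T(3)] T g_zero_right by (cases "g p a' a' = 0") (auto simp: c_def)
  have ca: "c *\<^sub>R a' \<in> T p" using T subspace_scale[OF sub] by auto
  have "w + c *\<^sub>R a' \<in> span (insert a b)"
  proof -
    have "span b \<subseteq> span (insert a b)" by (rule span_mono) auto
    then have "w \<in> span (insert a b)" "a0 \<in> span (insert a b)" "a \<in> span (insert a b)"
      using a0 w by (auto intro: span_base)
    then show ?thesis unfolding a'_def by (intro span_add span_scale span_diff)
  qed
  moreover have "g p (v - (w + c *\<^sub>R a')) u = 0" if u_in: "u \<in> span (insert a b)" for u
  proof -
    obtain k where k: "u - k *\<^sub>R a \<in> span b" using u_in unfolding span_breakdown_eq by (rule exE)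
    define u0 where "u0 = (u - k *\<^sub>R a) + k *\<^sub>R a0"
    have u0: "u0 \<in> span b" using k a0 by (auto simp: u0_def intro: span_add span_scale)
    have u: "u = k *\<^sub>R a' + u0" by (simp add: u0_def a'_def algebra_simps)
    have uT: "u0 \<in> T p" "k *\<^sub>R a' \<in> T p" using u0 span_T T subspace_scale[OF sub] by auto
    have uT': "u \<in> T p" unfolding u using uT subspace_add[OF sub] by auto
    have "g p (v - (w + c *\<^sub>R a')) u = g p ((v - w) - c *\<^sub>R a') u" by (simp add: algebra_simps)
    also have "\<dots> = g p (v - w) u - c * g p a' u"
      using T uT' ca by (simp add: g_diff_left g_scale_left)
    also have "\<dots> = k * (g p (v - w) a' - c * g p a' a')"
      using T uT u0 w(2) a0(2) unfolding u
      by (simp add: g_add_right g_scale_right algebra_simps flip: a'_def)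
    also have "\<dots> = 0" using c by simp
    finally show ?thesis .
  qed
  ultimately show ?case by blast
qed

lemma orth_proj_eqI:
  assumes S: "subspace S" "S \<subseteq> T p" and v: "v \<in> T p" and w: "w \<in> S" "\<forall>u\<in>S. g p (v - w) u = 0"
  shows "orth_proj g p S v = w"
  unfolding orth_proj_def
proof (rule the_equality)
  show "w \<in> S \<and> (\<forall>u\<in>S. g p (v - w) u = 0)" using w by simp
  fix x assume x: "x \<in> S \<and> (\<forall>u\<in>S. g p (v - x) u = 0)"
  note sub = subspace_tangent_space[of M p]
  have d: "x - w \<in> S" using x w subspace_diff[OF S(1)] by auto
  have T: "x \<in> T p" "w \<in> T p" "x - w \<in> T p" "v - w \<in> T p" "v - x \<in> T p"
    using x w d S v by (auto intro: subspace_diff[OF sub])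
  have "g p ((v - w) - (v - x)) (x - w) = 0"
    using g_diff_left[OF T(4,5,3)] x w d by simp
  then have "g p (x - w) (x - w) = 0" by simp
  then show "x = w" using g_eq_0[OF T(3)] by simp
qed

lemma orth_proj_add_perp:
  assumes S: "subspace S" "S \<subseteq> T p" "S = span b" "finite b" and v: "v \<in> T p"
  shows "orth_proj g p S v + orth_proj g p (perp M g p S) v = v"
proof -
  note sub = subspace_tangent_space[of M p]
  have "b \<subseteq> T p" using S span_superset by blast
  then obtain w where w: "w \<in> S" "\<forall>u\<in>S. g p (v - w) u = 0"
    using orth_proj_span_exists[OF S(4) _ v] S(3) by auto
  have wT: "w \<in> T p" "v - w \<in> T p" using w S v subspace_diff[OF sub] by auto
  have 1: "orth_proj g p S v = w" by (rule orth_proj_eqI[OF S(1,2) v w])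
  have 2: "orth_proj g p (perp M g p S) v = v - w"
  proof (rule orth_proj_eqI[OF subspace_perp[OF S(2)] _ v])
    show "perp M g p S \<subseteq> T p" by (auto simp: perp_def)
    show "v - w \<in> perp M g p S" using w wT by (auto simp: perp_def)
    show "\<forall>u\<in>perp M g p S. g p (v - (v - w)) u = 0"
      using w wT g_sym by (auto simp: perp_def)
  qed
  show "orth_proj g p S v + orth_proj g p (perp M g p S) v = v" using 1 2 by simp
qed

end

section \<open>The Levi-Civita connection\<close>

lemma smooth_fun_on_metric:
  "smooth_field_on M W X \<Longrightarrow> smooth_field_on M W Y \<Longrightarrow> smooth_fun_on M W (\<lambda>q. g q (X q) (Y q))"
  using riemannian unfolding riemannian_manifold_def riemannian_metric_def by simp

lemma smooth_fun_at_metric: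
  assumes "smooth_field_at M p X" "smooth_field_at M p Y"
  shows "smooth_fun_at M p (\<lambda>q. g q (X q) (Y q))"
proof -
  obtain W where "p \<in> W" "smooth_field_on M W X" "smooth_field_on M W Y"
    using smooth_field_at_common[OF assms] .
  then show ?thesis unfolding smooth_fun_at_def using smooth_fun_on_metric[of W X Y] by blast
qed

lemma conn: "connection M nab"
  using riemannian unfolding riemannian_manifold_def levi_civita_def by blast

context
  fixes p v Y assumes v: "v \<in> T p" and Y: "smooth_field_at M p Y"
begin

lemma nab_tangent: "nab p v Y \<in> T p"
  and nab_scale_left: "nab p (a *\<^sub>R v) Y = a *\<^sub>R nab p v Y"
  and nab_add_right: "smooth_field_at M p Y' \<Longrightarrow> nab p v (\<lambda>q. Y q + Y' q) = nab p v Y + nab p v Y'"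
  using conn v Y smooth_field_at_pts[OF Y] unfolding connection_def by blast+

lemma nab_metric:
  "smooth_field_at M p X \<Longrightarrow>
    v (\<lambda>q. g q (Y q) (X q)) = g p (nab p v Y) (X p) + g p (Y p) (nab p v X)"
  using riemannian v Y smooth_field_at_pts[OF Y]
  unfolding riemannian_manifold_def levi_civita_def metric_compatible_def by blast

end

lemma nab_zero_left: "smooth_field_at M p Y \<Longrightarrow> nab p 0 Y = 0"
  using nab_scale_left[of 0 p Y 0] by simp

lemma nab_zero_right: "p \<in> pts M \<Longrightarrow> v \<in> T p \<Longrightarrow> nab p v (\<lambda>q. 0) = 0"
  using nab_add_right[of v p "\<lambda>q. 0" "\<lambda>q. 0"] smooth_field_at_zero[of p M] by simp

lemma nab_smooth_on:
  "smooth_field_on M W X \<Longrightarrow> smooth_field_on M W Y \<Longrightarrow> smooth_field_on M W (\<lambda>q. nab q (X q) Y)"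
  using conn unfolding connection_def by blast

lemma nab_smooth_at:
  assumes "smooth_field_at M p X" "smooth_field_at M p Y"
  shows "smooth_field_at M p (\<lambda>q. nab q (X q) Y)"
proof -
  obtain W where "p \<in> W" "smooth_field_on M W X" "smooth_field_on M W Y"
    using smooth_field_at_common[OF assms] .
  then show ?thesis unfolding smooth_field_at_def using nab_smooth_on[of W X Y] by blast
qed

text \<open>By the product rule \<open>XX\<bar>Y\<bar>\<^sup>2 = 2 g(\<nabla>\<^sub>X\<nabla>\<^sub>XY, Y) + 2 \<bar>\<nabla>\<^sub>XY\<bar>\<^sup>2\<close>, and at a zero of \<open>Y\<close> the first term
  disappears.\<close>

lemma second_derivative_norm_at_zero:
  assumes X: "smooth_field_on M W X" and Y: "smooth_field_on M W Y" and p: "p \<in> W" and 0: "Y p = 0"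
  shows "X p (\<lambda>q. X q (\<lambda>r. g r (Y r) (Y r))) = 2 * g p (nab p (X p) Y) (nab p (X p) Y)"
proof -
  note at = smooth_field_on_tangent[OF X] smooth_field_on_imp_at[OF Y] smooth_field_on_imp_at[OF X]
  note t = at(1) and Yat = at(2) and Xat = at(3)
  have W: "openin (mtop M) W" "p \<in> pts M"
    using smooth_field_on_open[OF X] openin_subset p by auto
  have 1: "X q (\<lambda>r. g r (Y r) (Y r)) = 2 * g q (nab q (X q) Y) (Y q)" if "q \<in> W" for q
    using nab_metric[OF t[OF that] Yat[OF that] Yat[OF that]]
      g_sym[OF smooth_field_at_pts[OF Yat[OF that]] nab_tangent[OF t[OF that] Yat[OF that]]
        smooth_field_on_tangent[OF Y that]] by simp
  have nY: "smooth_field_at M p (\<lambda>q. nab q (X q) Y)" by (rule nab_smooth_at[OF Xat[OF p] Yat[OF p]])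
  have "X p (\<lambda>q. X q (\<lambda>r. g r (Y r) (Y r))) = X p (\<lambda>q. 2 * g q (nab q (X q) Y) (Y q))"
    by (rule tangent_germ[OF manifold t[OF p] W(2) eventually_nearI[OF W(1) p]]) (rule 1)
  also have "\<dots> = 2 * X p (\<lambda>q. g q (nab q (X q) Y) (Y q))"
    by (rule tangent_scale[OF t[OF p] smooth_fun_at_metric[OF nY Yat[OF p]]])
  also have "X p (\<lambda>q. g q (nab q (X q) Y) (Y q)) =
      g p (nab p (X p) (\<lambda>q. nab q (X q) Y)) (Y p) + g p (nab p (X p) Y) (nab p (X p) Y)"
    by (rule nab_metric[OF t[OF p] nY Yat[OF p]])
  also have "\<dots> = g p (nab p (X p) Y) (nab p (X p) Y)"
    using g_zero_right[OF W(2) nab_tangent[OF t[OF p] nY]] 0 by simp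
  finally show ?thesis .
qed

end

section \<open>Covariant derivatives along a map\<close>

context riemannian
begin

context
  fixes N :: "('c, 'd::euclidean_space) mfd" and F :: "'c \<Rightarrow> 'a" and p :: 'c
    and v :: "'c tvec" and X :: "'a \<Rightarrow> 'a tvec"
  assumes N: "smooth_manifold N" and F: "smooth_map N M F" and p: "p \<in> pts N"
    and v: "v \<in> tangent_space N p"
    and X: "smooth_field_at M (F p) X" "X (F p) = push M F p v"
begin

lemma push_in_T: "push M F p v \<in> T (F p)"
  by (rule push_tangent[OF N manifold F v p])

lemma derivative_metric_along:
  assumes a: "smooth_fun_at N p a" and E: "smooth_field_at M (F p) E" and G: "smooth_field_at M (F p) G"
  shows "smooth_fun_at N p (\<lambda>q. a q * g (F q) (E (F q)) (G (F q)))"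
    and "v (\<lambda>q. a q * g (F q) (E (F q)) (G (F q))) =
      v a * g (F p) (E (F p)) (G (F p)) +
      a p * (g (F p) (nab (F p) (push M F p v) E) (G (F p)) +
             g (F p) (E (F p)) (nab (F p) (push M F p v) G))"
proof -
  let ?h = "\<lambda>q. g q (E q) (G q)"
  have h: "smooth_fun_at M (F p) ?h" by (rule smooth_fun_at_metric[OF E G])
  have hF: "smooth_fun_at N p (?h \<circ> F)" by (rule smooth_fun_at_compose[OF N manifold F h p])
  show "smooth_fun_at N p (\<lambda>q. a q * g (F q) (E (F q)) (G (F q)))"
    using smooth_fun_at_mult[OF a hF] by (simp add: o_def)
  have "v (?h \<circ> F) = push M F p v ?h" by (simp add: push_apply[of M F p ?h, OF h])
  also have "\<dots> = g (F p) (nab (F p) (push M F p v) E) (G (F p)) +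
             g (F p) (E (F p)) (nab (F p) (push M F p v) G)"
    by (rule nab_metric[OF push_in_T E G])
  finally show "v (\<lambda>q. a q * g (F q) (E (F q)) (G (F q))) =
      v a * g (F p) (E (F p)) (G (F p)) +
      a p * (g (F p) (nab (F p) (push M F p v) E) (G (F p)) +
             g (F p) (E (F p)) (nab (F p) (push M F p v) G))"
    using tangent_mult[OF v a hF] by (simp add: o_def)
qed

text \<open>Metric compatibility determines the pairing of the covariant derivative with every field \<open>G\<close>
  from \<open>V\<close> alone. Since \<open>F\<^sub>*v\<close> extends to a field \<open>X\<close>, the value of the covariant derivative extends
  to a field as well, so that it may itself be chosen as \<open>G\<close> when two such values are compared.\<close>

lemma pullback_representation_pairing:
  assumes W: "openin (mtop N) W" "p \<in> W"
    and aE: "\<And>i. i < k \<Longrightarrow> smooth_fun_on N W (a i) \<and> smooth_field_at M (F p) (E i)"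
    and V: "\<forall>q\<in>W. V q = (\<Sum>i<(k::nat). a i q *\<^sub>R E i (F q))"
    and w: "w = (\<Sum>i<k. v (a i) *\<^sub>R E i (F p) + a i p *\<^sub>R nab (F p) (push M F p v) (E i))"
  shows "\<exists>H. smooth_field_at M (F p) H \<and> H (F p) = w"
    and "smooth_field_at M (F p) G \<Longrightarrow>
      g (F p) w (G (F p)) =
        v (\<lambda>q. g (F q) (V q) (G (F q))) - g (F p) (V p) (nab (F p) (push M F p v) G)"
proof -
  let ?u = "push M F p v"
  have Fp: "F p \<in> pts M" by (rule smooth_field_at_pts[OF X(1)])
  have a: "smooth_fun_at N p (a i)" and E: "smooth_field_at M (F p) (E i)" if "i < k" for i
    using aE[OF that] W unfolding smooth_fun_at_def by auto
  note sub = subspace_tangent_space[of M "F p"]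
  have ET: "E i (F p) \<in> T (F p)" "nab (F p) ?u (E i) \<in> T (F p)" if "i < k" for i
    using smooth_field_at_tangent[OF E[OF that]] nab_tangent[OF push_in_T E[OF that]] .
  define H where "H = (\<lambda>q. \<Sum>i<k. v (a i) *\<^sub>R E i q + a i p *\<^sub>R nab q (X q) (E i))"
  have "smooth_field_at M (F p) H"
    unfolding H_def
    by (intro smooth_field_at_sum smooth_field_at_add smooth_field_at_scale nab_smooth_at X(1) E Fp)
  moreover have "H (F p) = w" by (simp add: H_def w X(2))
  ultimately show "\<exists>H. smooth_field_at M (F p) H \<and> H (F p) = w" by blast
  assume G: "smooth_field_at M (F p) G"
  let ?G = "G (F p)" and ?DG = "nab (F p) ?u G"
  have GT: "?G \<in> T (F p)" "?DG \<in> T (F p)"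
    using smooth_field_at_tangent[OF G] nab_tangent[OF push_in_T G] .
  have T': "v (a i) *\<^sub>R E i (F p) \<in> T (F p)" "a i p *\<^sub>R nab (F p) ?u (E i) \<in> T (F p)"
      "a i p *\<^sub>R E i (F p) \<in> T (F p)" if "i < k" for i
    using ET[OF that] by (auto intro: subspace_scale[OF sub])
  have gw: "g (F p) w ?G =
      (\<Sum>i<k. v (a i) * g (F p) (E i (F p)) ?G + a i p * g (F p) (nab (F p) ?u (E i)) ?G)"
    unfolding w
    using GT ET T'
    by (subst g_sum_left[OF Fp])
       (auto simp: g_add_left[OF Fp] g_scale_left[OF Fp] simp del: plus_fun_apply intro!: subspace_add[OF sub])
  have gV: "g (F p) (V p) ?DG = (\<Sum>i<k. a i p * g (F p) (E i (F p)) ?DG)"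
    unfolding V[rule_format, OF W(2)]
    using GT ET T' by (subst g_sum_left[OF Fp]) (auto simp: g_scale_left[OF Fp])
  have ev: "\<forall>\<^sub>F q in near N p. g (F q) (V q) (G (F q)) =
      (\<Sum>i<k. a i q * g (F q) (E i (F q)) (G (F q)))"
  proof -
    have "\<forall>\<^sub>F q in near N p. \<forall>i\<in>{..<k}. E i (F q) \<in> T (F q)"
      using eventually_near_compose[OF F p smooth_field_at_near[OF E]]
      by (intro eventually_ball_finite) auto
    moreover have "\<forall>\<^sub>F q in near N p. G (F q) \<in> T (F q)"
      by (rule eventually_near_compose[OF F p smooth_field_at_near[OF G]])
    moreover have "\<forall>\<^sub>F q in near N p. V q = (\<Sum>i<k. a i q *\<^sub>R E i (F q)) \<and> F q \<in> pts M"
    proof (rule eventually_nearI[OF W])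
      have "F q \<in> pts M" if "q \<in> pts N" for q
        using F that unfolding smooth_map_def by (auto simp: continuous_map_def)
      then show "V q = (\<Sum>i<k. a i q *\<^sub>R E i (F q)) \<and> F q \<in> pts M" if "q \<in> W" for q
        using that V openin_subset[OF W(1)] by blast
    qed
    ultimately show ?thesis
    proof eventually_elim
      case (elim q)
      then have Fq: "F q \<in> pts M" and "V q = (\<Sum>i<k. a i q *\<^sub>R E i (F q))" by auto
      then show ?case
        using elim subspace_scale[OF subspace_tangent_space, of _ M "F q"]
        by (simp add: g_sum_left[OF Fq] g_scale_left[OF Fq])
    qed
  qed
  have "v (\<lambda>q. g (F q) (V q) (G (F q))) = v (\<lambda>q. \<Sum>i<k. a i q * g (F q) (E i (F q)) (G (F q)))"
    by (rule tangent_germ[OF N v p ev])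
  also have "\<dots> = (\<Sum>i<k. v (\<lambda>q. a i q * g (F q) (E i (F q)) (G (F q))))"
    by (rule tangent_sum[OF v p derivative_metric_along(1)[OF a E G]])
  also have "\<dots> = (\<Sum>i<k. v (a i) * g (F p) (E i (F p)) ?G +
      a i p * (g (F p) (nab (F p) ?u (E i)) ?G + g (F p) (E i (F p)) ?DG))"
    by (rule sum.cong[OF refl]) (rule derivative_metric_along(2)[OF a E G], simp_all)
  finally show "g (F p) w ?G = v (\<lambda>q. g (F q) (V q) (G (F q))) - g (F p) (V p) ?DG"
    unfolding gw gV by (simp add: sum.distrib algebra_simps)
qed

lemma pullback_cov_eq:
  assumes E: "smooth_field_at M (F p) E" and V: "\<forall>\<^sub>F q in near N p. V q = E (F q)"
  shows "pullback_cov N M nab F p v V = nab (F p) (push M F p v) E"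
proof -
  let ?u = "push M F p v" and ?w = "nab (F p) (push M F p v) E"
  define rep where "rep = (\<lambda>w. \<exists>(k::nat) a E W. openin (mtop N) W \<and> p \<in> W \<and>
     (\<forall>i<k. smooth_fun_on N W (a i) \<and> smooth_field_at M (F p) (E i)) \<and>
     (\<forall>q\<in>W. V q = (\<Sum>i<k. a i q *\<^sub>R E i (F q))) \<and>
     w = (\<Sum>i<k. v (a i) *\<^sub>R E i (F p) + a i p *\<^sub>R nab (F p) ?u (E i)))"
  have Fp: "F p \<in> pts M" by (rule smooth_field_at_pts[OF X(1)])
  have rep: "\<exists>H. smooth_field_at M (F p) H \<and> H (F p) = w"
    "smooth_field_at M (F p) G \<Longrightarrow>
      g (F p) w (G (F p)) = v (\<lambda>q. g (F q) (V q) (G (F q))) - g (F p) (V p) (nab (F p) ?u G)"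
    if "rep w" for w G
  proof -
    obtain k a E W where *: "openin (mtop N) W" "p \<in> W"
      "\<And>i. i < k \<Longrightarrow> smooth_fun_on N W (a i) \<and> smooth_field_at M (F p) (E i)"
      "\<forall>q\<in>W. V q = (\<Sum>i<(k::nat). a i q *\<^sub>R E i (F q))"
      "w = (\<Sum>i<k. v (a i) *\<^sub>R E i (F p) + a i p *\<^sub>R nab (F p) (push M F p v) (E i))"
      using \<open>rep w\<close> unfolding rep_def by auto
    show "\<exists>H. smooth_field_at M (F p) H \<and> H (F p) = w"
      by (rule pullback_representation_pairing(1)[OF *])
    show "smooth_field_at M (F p) G \<Longrightarrow>
      g (F p) w (G (F p)) = v (\<lambda>q. g (F q) (V q) (G (F q))) - g (F p) (V p) (nab (F p) ?u G)"
      by (rule pullback_representation_pairing(2)[OF *])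
  qed
  have rep_w: "rep ?w"
  proof -
    obtain W where "openin (mtop N) W" "p \<in> W" "\<forall>q\<in>W. V q = E (F q)"
      using V p by (auto simp: eventually_near)
    then show ?thesis
      unfolding rep_def using E smooth_fun_on_const[of N W 1] tangent_const[OF v p, of 1]
      by (intro exI[of _ 1] exI[of _ "\<lambda>_ _. 1"] exI[of _ "\<lambda>_. E"] exI[of _ W]) simp
  qed
  have unique: "w = ?w" if w: "rep w" for w
  proof -
    obtain H H' where H: "smooth_field_at M (F p) H" "H (F p) = w"
      "smooth_field_at M (F p) H'" "H' (F p) = ?w"
      using rep(1)[OF w] rep(1)[OF rep_w] by auto
    define G where "G = (\<lambda>q. H q + (- 1) *\<^sub>R H' q)"
    have G: "smooth_field_at M (F p) G"
      unfolding G_def by (intro smooth_field_at_add smooth_field_at_scale H)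
    have G_w: "G (F p) = w - ?w" by (simp add: G_def H)
    have T: "w \<in> T (F p)" "?w \<in> T (F p)" "w - ?w \<in> T (F p)"
      using smooth_field_at_tangent[OF H(1)] smooth_field_at_tangent[OF H(3)]
        smooth_field_at_tangent[OF G] H G_w by auto
    have "g (F p) w (w - ?w) = g (F p) ?w (w - ?w)"
      using rep(2)[OF w G] rep(2)[OF rep_w G] G_w by simp
    then have "g (F p) (w - ?w) (w - ?w) = 0" using g_diff_left[OF Fp T] by simp
    then show ?thesis using g_eq_0[OF Fp T(3)] by simp
  qed
  have "pullback_cov N M nab F p v V = (THE w. rep w)"
    unfolding pullback_cov_def rep_def by (rule refl)
  then show ?thesis using the_equality[of rep, OF rep_w unique] by simp
qed

lemma nab_eq_0_if_vanishes_along: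
  assumes E: "smooth_field_at M (F p) E" and 0: "\<forall>\<^sub>F q in near N p. E (F q) = 0"
  shows "nab (F p) (push M F p v) E = 0"
proof -
  have Fp: "F p \<in> pts M" by (rule smooth_field_at_pts[OF X(1)])
  have "nab (F p) (push M F p v) E = pullback_cov N M nab F p v (\<lambda>q. E (F q))"
    by (rule pullback_cov_eq[OF E, symmetric]) simp
  also have "\<dots> = nab (F p) (push M F p v) (\<lambda>q. 0)"
    by (rule pullback_cov_eq[OF smooth_field_at_zero[OF Fp] 0])
  finally show ?thesis using nab_zero_right[OF Fp push_in_T] by simp
qed

end

end

text \<open>Both sides are half the second derivative, along \<open>X\<close> and along \<open>X'\<close>, of one function read upstairs
  and downstairs: \<open>\<bar>Y\<bar>\<^sup>2 = \<bar>Y'\<bar>\<^sup>2 \<circ> F\<close>. This controls the derivative of a horizontal lift \<open>Y\<close> of \<open>Y'\<close> at a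
  zero also in those directions that \<open>F\<^sub>*\<close> kills.\<close>

lemma nab_norm_eq_at_zero_of_related_fields:
  assumes "riemannian N gN nabN" and "riemannian B gB nabB" and F: "smooth_map N B F"
    and X: "smooth_field_on N U X" and Y: "smooth_field_on N U Y"
    and X': "smooth_field_on B W X'" and Y': "smooth_field_on B W Y'"
    and UW: "F ` U \<subseteq> W"
    and push_X: "\<And>q. q \<in> U \<Longrightarrow> push B F q (X q) = X' (F q)"
    and norm_Y: "\<And>q. q \<in> U \<Longrightarrow> gN q (Y q) (Y q) = gB (F q) (Y' (F q)) (Y' (F q))"
    and y: "y \<in> U" and 0: "Y y = 0" "Y' (F y) = 0"
  shows "gN y (nabN y (X y) Y) (nabN y (X y) Y) =
    gB (F y) (nabB (F y) (X' (F y)) Y') (nabB (F y) (X' (F y)) Y')"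
proof -
  interpret N: riemannian N gN nabN by fact
  interpret B: riemannian B gB nabB by fact
  define f where "f = (\<lambda>q. gN q (Y q) (Y q))"
  define h where "h = (\<lambda>q. gB q (Y' q) (Y' q))"
  have U: "openin (mtop N) U" using X by (rule smooth_field_on_open)
  have derivative: "X q e = X' (F q) k" if q: "q \<in> U" and k: "smooth_fun_on B W k"
    and e: "\<And>r. r \<in> U \<Longrightarrow> e r = k (F r)" for q e k
  proof -
    have "X q e = X q (k \<circ> F)"
      by (rule tangent_germ[OF N.manifold smooth_field_on_tangent[OF X q]
            subsetD[OF openin_subset[OF U] q] eventually_nearI[OF U q]]) (simp add: e)
    also have "\<dots> = push B F q (X q) k"
      using k q UW by (intro push_apply[symmetric]) (auto simp: smooth_fun_at_def)
    finally show ?thesis by (simp add: push_X[OF q])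
  qed
  have h: "smooth_fun_on B W h" unfolding h_def by (rule B.smooth_fun_on_metric[OF Y' Y'])
  have "X q f = X' (F q) h" if "q \<in> U" for q
    by (rule derivative[OF that h]) (simp add: f_def h_def norm_Y)
  then have "X y (\<lambda>q. X q f) = X' (F y) (\<lambda>q. X' q h)"
    by (intro derivative[OF y smooth_field_on_apply[OF X' order_refl h]])
  moreover have "F y \<in> W" using y UW by auto
  ultimately show ?thesis
    using N.second_derivative_norm_at_zero[OF X Y y 0(1)]
      B.second_derivative_norm_at_zero[OF X' Y' _ 0(2)]
    by (simp add: f_def h_def)
qed

section \<open>Geodesics and the Sasakian structure\<close>

lemma velocity_tangent:
  assumes "smooth_manifold M" "open I" "smooth_map (interval_mfd I) M \<gamma>" "t \<in> I"
  shows "velocity M I \<gamma> t \<in> tangent_space M (\<gamma> t)"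
  unfolding velocity_def
  by (rule push_tangent[OF smooth_manifold_interval[OF assms(2)] assms(1,3) ddt_tangent[OF assms(2,4)]])
     (use assms(4) in simp)

text \<open>A velocity field that is locally the restriction of a field on the manifold turns the geodesic
  equation into a pointwise one.\<close>

lemma (in riemannian) geodesic_iff:
  assumes I: "open I" and \<sigma>: "smooth_map (interval_mfd I) M \<sigma>"
    and X: "\<And>t. t \<in> I \<Longrightarrow> smooth_field_at M (\<sigma> t) (X t)"
    and vel: "\<And>t. t \<in> I \<Longrightarrow> \<forall>\<^sub>F s in near (interval_mfd I) t. velocity M I \<sigma> s = X t (\<sigma> s)"
  shows "geodesic M nab I \<sigma> \<longleftrightarrow> (\<forall>t\<in>I. nab (\<sigma> t) (X t (\<sigma> t)) (X t) = 0)"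
proof -
  have "pullback_cov (interval_mfd I) M nab \<sigma> t (ddt I t) (velocity M I \<sigma>) =
      nab (\<sigma> t) (X t (\<sigma> t)) (X t)" if t: "t \<in> I" for t
  proof -
    have v: "X t (\<sigma> t) = push M \<sigma> t (ddt I t)"
      using eventually_near_self[OF vel[OF t]] t by (simp add: velocity_def)
    show ?thesis
      using pullback_cov_eq[OF smooth_manifold_interval[OF I] \<sigma> _ ddt_tangent[OF I t] X[OF t] v X[OF t] vel[OF t]]
        t v by simp
  qed
  then show ?thesis using \<sigma> unfolding geodesic_def by simp
qed

text \<open>\<open>(\<nabla>\<phi>)\<close> expresses the derivative of \<open>\<phi>X\<close> through \<open>\<phi>\<nabla>\<^sub>XX\<close>. As \<open>\<phi>\<close> has kernel spanned by \<open>\<xi>\<close>,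
  applying it to the acceleration loses only \<open>\<eta>(\<nabla>\<^sub>XX) = X(\<eta>(X)) + g(X, \<phi>X)\<close>, which vanishes for a
  curve orthogonal to \<open>\<xi>\<close>.\<close>

lemma acceleration_eq_0_iff_sasakian:
  assumes B: "sasakian_manifold B \<phi> \<xi> \<eta> gB nabB" and I: "open I" "t \<in> I"
    and \<sigma>: "smooth_map (interval_mfd I) B \<sigma>"
    and X: "smooth_field_at B (\<sigma> t) X" "X (\<sigma> t) = velocity B I \<sigma> t"
    and horizontal: "\<forall>\<^sub>F s in near (interval_mfd I) t. gB (\<sigma> s) (X (\<sigma> s)) (\<xi> (\<sigma> s)) = 0"
  shows "nabB (\<sigma> t) (X (\<sigma> t)) X = 0 \<longleftrightarrow>
    nabB (\<sigma> t) (X (\<sigma> t)) (\<lambda>q. \<phi> q (X q)) = gB (\<sigma> t) (X (\<sigma> t)) (X (\<sigma> t)) *\<^sub>R \<xi> (\<sigma> t)"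
proof -
  interpret B: riemannian B gB nabB
    by standard (use B in \<open>simp add: sasakian_manifold_def\<close>)
  define p where "p = \<sigma> t"
  define u where "u = X p"
  define A where "A = nabB p u X"
  have p: "p \<in> pts B" unfolding p_def by (rule smooth_field_at_pts[OF X(1)])
  have Xp: "smooth_field_at B p X" using X(1) by (simp add: p_def)
  have u: "u \<in> B.T p" unfolding u_def by (rule smooth_field_at_tangent[OF Xp])
  have A: "A \<in> B.T p" unfolding A_def by (rule B.nab_tangent[OF u Xp])
  have \<xi>: "smooth_field_at B p \<xi>"
    by (rule smooth_field_on_imp_at[OF _ p]) (use B in \<open>simp add: sasakian_manifold_def\<close>)
  have sas: "\<forall>u\<in>B.T p. \<phi> p u \<in> B.T p \<and> \<phi> p (\<phi> p u) = - u + \<eta> p u *\<^sub>R \<xi> p \<and>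
      \<eta> p u = gB p u (\<xi> p) \<and> nabB p u \<xi> = - \<phi> p u \<and>
      (\<forall>a. \<phi> p (a *\<^sub>R u) = a *\<^sub>R \<phi> p u) \<and>
      (\<forall>v\<in>B.T p. gB p (\<phi> p u) v = - gB p u (\<phi> p v)) \<and>
      (\<forall>V. smooth_field_at B p V \<longrightarrow> nabB p u (\<lambda>q. \<phi> q (V q)) - \<phi> p (nabB p u V) =
        gB p u (V p) *\<^sub>R \<xi> p - \<eta> p (V p) *\<^sub>R u)"
    using B p unfolding sasakian_manifold_def by simp
  have \<phi>0: "\<phi> p 0 = 0" using sas u by (metis scaleR_zero_left)
  have gu\<xi>: "gB p u (\<xi> p) = 0"
    using eventually_near_self[OF horizontal] I(2) by (simp add: p_def u_def)
  have \<eta>u: "\<eta> p u = 0" using sas u gu\<xi> by simp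
  have "nabB p u (\<lambda>q. \<phi> q (X q)) - \<phi> p A = gB p u u *\<^sub>R \<xi> p - \<eta> p u *\<^sub>R u"
    using sas u Xp unfolding A_def u_def by blast
  then have C: "nabB p u (\<lambda>q. \<phi> q (X q)) = \<phi> p A + gB p u u *\<^sub>R \<xi> p"
    using \<eta>u by (simp add: algebra_simps del: zero_fun_apply plus_fun_apply)
  have \<eta>A: "\<eta> p A = 0"
  proof -
    let ?h = "\<lambda>q. gB q (X q) (\<xi> q)"
    have h: "smooth_fun_at B (\<sigma> t) ?h" using B.smooth_fun_at_metric[OF Xp \<xi>] by (simp add: p_def)
    have "u ?h = ddt I t (?h \<circ> \<sigma>)"
      using push_apply[of B \<sigma> t ?h, OF h] X(2) by (simp add: u_def p_def velocity_def)
    also have "\<dots> = 0"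
      by (rule tangent_vanish[OF smooth_manifold_interval[OF I(1)] ddt_tangent[OF I]])
         (use I horizontal in \<open>simp_all add: o_def\<close>)
    finally have "u ?h = 0" .
    moreover have "u ?h = gB p A (\<xi> p) + gB p u (nabB p u \<xi>)"
      using B.nab_metric[OF u Xp \<xi>] by (simp add: A_def u_def)
    moreover have "gB p u (\<phi> p u) = 0"
      using sas u B.g_sym[OF p, of u "\<phi> p u"] by fastforce
    then have "gB p u (nabB p u \<xi>) = 0"
      using sas u B.g_minus_right[OF p u, of "\<phi> p u"] by simp
    ultimately show ?thesis using sas A by simp
  qed
  have "A = 0 \<longleftrightarrow> \<phi> p A = 0"
  proof
    assume "\<phi> p A = 0"
    then have "\<phi> p (\<phi> p A) = 0" using \<phi>0 by simp
    then show "A = 0" using sas A \<eta>A by simp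
  qed (simp add: \<phi>0)
  then show ?thesis using C unfolding A_def u_def p_def[symmetric] by simp
qed

section \<open>The range of the differential\<close>

lemma subspace_rangeF: "subspace (rangeF N B F y)"
  unfolding rangeF_def by (rule linear_subspace_image[OF linear_push subspace_tangent_space])

lemma rangeF_subset_tangent:
  "smooth_manifold N \<Longrightarrow> smooth_manifold B \<Longrightarrow> smooth_map N B F \<Longrightarrow> y \<in> pts N \<Longrightarrow>
    rangeF N B F y \<subseteq> tangent_space B (F y)"
  unfolding rangeF_def by (intro image_subsetI push_tangent)

text \<open>The dimension of an infinite-dimensional space is \<open>0\<close> by convention, so that positive dimension
  forces a finite basis.\<close>

lemma finite_spanning_set_if_dim_pos:
  assumes "subspace S" "0 < dim S"
  obtains b where "finite b" "S = span b"
proof -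
  obtain b where b: "b \<subseteq> S" "S \<subseteq> span b" "card b = dim S"
    by (rule real_vector.basis_exists[of S])
  have "finite b" using assms(2) b(3) card_gt_0_iff[of b] by simp
  moreover have "S = span b" using b(2) span_minimal[OF b(1) assms(1)] by (rule subset_antisym)
  ultimately show thesis by (rule that)
qed

section \<open>The geodesic equation for an anti-invariant Riemannian map\<close>

theorem lemma3p1:
  fixes N :: "('a, 'e::euclidean_space) mfd" and B :: "('b, 'f::euclidean_space) mfd"
    and gN :: "'a metric" and nabN :: "'a conn"
    and \<phi> :: "'b \<Rightarrow> 'b tvec \<Rightarrow> 'b tvec" and \<xi> :: "'b \<Rightarrow> 'b tvec" and \<eta> :: "'b \<Rightarrow> 'b tvec \<Rightarrow> real"
    and gB :: "'b metric" and nabB :: "'b conn"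
    and F :: "'a \<Rightarrow> 'b" and r :: nat
    and Q :: "'b set" and D :: "'b \<Rightarrow> 'b tvec set"
    and I :: "real set" and \<gamma> :: "real \<Rightarrow> 'a" and \<sigma> :: "real \<Rightarrow> 'b"
    and U :: "real \<Rightarrow> 'a set" and W :: "real \<Rightarrow> 'b set"
    and Y1 Y :: "real \<Rightarrow> 'a \<Rightarrow> 'a tvec" and FY1 Z BZ CZ :: "real \<Rightarrow> 'b \<Rightarrow> 'b tvec"
  assumes N: "riemannian_manifold N gN nabN"
    and B: "sasakian_manifold B \<phi> \<xi> \<eta> gB nabB"
    and F: "riemannian_map N gN B gB r F" "anti_invariant N B gB \<phi> F"
    and reeb: "\<forall>y\<in>pts N. \<xi> (F y) \<in> perp B gB (F y) (rangeF N B F y)"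
    \<comment> \<open>\<open>(range F\<^sub>*)\<^sup>\<bottom>\<close> is (given along \<open>F\<close> by) a totally geodesic distribution \<open>D\<close> on a neighbourhood \<open>Q\<close> of \<open>F(N)\<close>\<close>
    and D: "smooth_distribution_on B Q (DIM('f) - r) D" "F ` pts N \<subseteq> Q"
      "\<forall>y\<in>pts N. D (F y) = perp B gB (F y) (rangeF N B F y)"
      "totally_geodesic_on B nabB Q D"
    and I: "open I" "is_interval I" "I \<noteq> {}"
    and \<gamma>: "geodesic N nabN I \<gamma>"
    and \<sigma>: "\<sigma> = F \<circ> \<gamma>"
    and nbhds: "\<forall>t\<in>I. openin (mtop N) (U t) \<and> \<gamma> t \<in> U t \<and> W t \<subseteq> Q \<and> F ` U t \<subseteq> W t"
    \<comment> \<open>\<open>F\<^sub>*Y\<^sub>1 \<in> \<Gamma>(range F\<^sub>*)\<close> and \<open>Z \<in> \<Gamma>(range F\<^sub>*)\<^sup>\<bottom>\<close>, the components of the velocity of \<open>\<sigma>\<close>\<close>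
    and Y1: "\<forall>t\<in>I. smooth_field_on N (U t) (Y1 t) \<and>
      section_on B (\<lambda>p. perp B gB p (D p)) (W t) (FY1 t) \<and>
      (\<forall>y\<in>U t. FY1 t (F y) = push B F y (Y1 t y))"
    and Z: "\<forall>t\<in>I. section_on B D (W t) (Z t)"
    and components: "\<forall>t\<in>I. \<forall>\<^sub>F s in nhds t. velocity B I \<sigma> s = FY1 t (\<sigma> s) + Z t (\<sigma> s)"
    \<comment> \<open>\<open>\<phi>Z = \<B>Z + \<C>Z\<close>\<close>
    and BZ: "\<forall>t\<in>I. section_on B (\<lambda>p. perp B gB p (D p)) (W t) (BZ t)"
    and CZ: "\<forall>t\<in>I. section_on B D (W t) (CZ t) \<and> (\<forall>y\<in>U t. CZ t (F y) \<in> mu N B gB \<phi> F y)"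
    and phiZ: "\<forall>t\<in>I. \<forall>p\<in>W t. \<phi> p (Z t p) = BZ t p + CZ t p"
    and Y: "\<forall>t\<in>I. section_on N (\<lambda>y. perp N gN y (kerF N B F y)) (U t) (Y t) \<and>
      (\<forall>y\<in>U t. push B F y (Y t y) = BZ t (F y))"
  shows "geodesic B nabB I \<sigma> \<longleftrightarrow> (\<forall>t\<in>I.
    let y = \<gamma> t; p = \<sigma> t;
        X1 = FY1 t p; Zp = Z t p;
        \<phi>FY1 = (\<lambda>q. \<phi> q (FY1 t q));
        v = gB p (velocity B I \<sigma> t) (velocity B I \<sigma> t)
    in
      - shape N B gB nabB F y \<phi>FY1 X1 - shape N B gB nabB F y (CZ t) X1
        + nabB p Zp (BZ t)
        + push B F y (orth_proj gN y (perp N gN y (kerF N B F y)) (nabN y (Y1 t y) (Y t)))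
        + \<eta> p Zp *\<^sub>R X1 = 0
    \<and>
      second_fundamental_form N nabN B nabB F (Y1 t) (Y t) y
        + normal_cov N B gB nabB F y X1 \<phi>FY1
        + normal_cov N B gB nabB F y Zp \<phi>FY1
        + normal_cov N B gB nabB F y Zp (CZ t)
        + normal_cov N B gB nabB F y X1 (CZ t)
        - v *\<^sub>R \<xi> p + \<eta> p Zp *\<^sub>R Zp = 0)"
proof -
  let ?J = "interval_mfd I"
  interpret N: riemannian N gN nabN by standard (rule N)
  interpret B: riemannian B gB nabB
    by standard (use B in \<open>simp add: sasakian_manifold_def\<close>)
  have J: "smooth_manifold ?J" by (rule smooth_manifold_interval[OF I(1)])
  have F_smooth: "smooth_map N B F" using F(1) unfolding riemannian_map_def by auto
  have \<gamma>_smooth: "smooth_map ?J N \<gamma>" using \<gamma> unfolding geodesic_def by auto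
  have \<sigma>_smooth: "smooth_map ?J B \<sigma>"
    unfolding \<sigma> by (rule smooth_map_compose[OF J N.manifold B.manifold \<gamma>_smooth F_smooth])
  have \<gamma>_pts: "\<gamma> s \<in> pts N" if "s \<in> I" for s using smooth_map_pts[OF \<gamma>_smooth] that by simp
  have \<sigma>_pts: "\<sigma> s \<in> pts B" if "s \<in> I" for s using smooth_map_pts[OF \<sigma>_smooth] that by simp
  have range_T: "rangeF N B F y \<subseteq> B.T (F y)" if "y \<in> pts N" for y
    by (rule rangeF_subset_tangent[OF N.manifold B.manifold F_smooth that])
  have velocity_\<sigma>: "velocity B I \<sigma> s = push B F (\<gamma> s) (velocity N I \<gamma> s)" if "s \<in> I" for s
    unfolding velocity_def \<sigma>
    by (rule push_compose[where F = F and G = \<gamma>, OF N.manifold B.manifold F_smooth]) (rule \<gamma>_pts[OF that])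
  have fields: "smooth_field_at N (\<gamma> t) (Y1 t)" "smooth_field_at N (\<gamma> t) (Y t)"
      "smooth_field_at B (\<sigma> t) (FY1 t)" "smooth_field_at B (\<sigma> t) (BZ t)"
      "smooth_field_at B (\<sigma> t) (CZ t)" "smooth_field_at B (\<sigma> t) (\<lambda>q. \<phi> q (FY1 t q))" if t: "t \<in> I" for t
  proof -
    have W: "\<sigma> t \<in> W t" using nbhds t unfolding \<sigma> by auto
    have U: "\<gamma> t \<in> U t" using nbhds t by auto
    show "smooth_field_at N (\<gamma> t) (Y1 t)" "smooth_field_at N (\<gamma> t) (Y t)"
      by (rule smooth_field_on_imp_at[OF _ U]; use Y1 Y t in \<open>simp add: section_on_def\<close>)+
    show "smooth_field_at B (\<sigma> t) (FY1 t)" "smooth_field_at B (\<sigma> t) (BZ t)" "smooth_field_at B (\<sigma> t) (CZ t)"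
      by (rule smooth_field_on_imp_at[OF _ W]; use Y1 BZ CZ t in \<open>simp add: section_on_def\<close>)+
    have "smooth_field_on B (W t) (\<lambda>q. \<phi> q (FY1 t q))"
      using B Y1 t unfolding sasakian_manifold_def section_on_def by simp
    then show "smooth_field_at B (\<sigma> t) (\<lambda>q. \<phi> q (FY1 t q))" by (rule smooth_field_on_imp_at[OF _ W])
  qed
  \<comment> \<open>\<open>\<sigma>' = F\<^sub>*\<gamma>'\<close> lies in the range of \<open>F\<^sub>*\<close>, so its normal component vanishes along the curve, and
    so do the parts \<open>BZ\<close> and \<open>CZ\<close> of \<open>\<phi>Z\<close>, one tangential and one normal with sum \<open>0\<close>\<close>
  have along: "\<forall>\<^sub>F s in near ?J t. velocity B I \<sigma> s = FY1 t (\<sigma> s) \<and> Z t (\<sigma> s) = 0 \<and>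
      BZ t (\<sigma> s) = 0 \<and> CZ t (\<sigma> s) = 0 \<and> gB (\<sigma> s) (FY1 t (\<sigma> s)) (\<xi> (\<sigma> s)) = 0" if t: "t \<in> I" for t
  proof -
    have 1: "\<forall>\<^sub>F s in near ?J t. velocity B I \<sigma> s = FY1 t (\<sigma> s) + Z t (\<sigma> s)"
      using components t by (intro near_intervalI) auto
    have 2: "\<forall>\<^sub>F s in near ?J t. \<gamma> s \<in> U t"
      using nbhds t \<gamma>_pts[OF t]
      by (intro eventually_near_compose[OF \<gamma>_smooth]) (auto intro: eventually_nearI)
    have 3: "\<forall>\<^sub>F s in near ?J t. s \<in> I"
      using t by (intro eventually_nearI[of ?J I]) (auto simp: interval_mfd_def)
    from 1 2 3 show ?thesis
    proof eventually_elim
      case (elim s)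
      let ?y = "\<gamma> s" and ?q = "\<sigma> s"
      let ?R = "rangeF N B F ?y" and ?P = "perp B gB ?q (rangeF N B F ?y)"
      have q: "?q = F ?y" "?q \<in> W t" "?q \<in> pts B" "?y \<in> pts N"
        using nbhds t elim \<sigma>_pts \<gamma>_pts unfolding \<sigma> by auto
      have D_q: "D ?q = ?P" using D(3) q by simp
      have R: "?R \<subseteq> B.T ?q" using range_T[OF q(4)] q(1) by simp
      have sub: "subspace ?R" "subspace ?P"
        by (rule subspace_rangeF) (rule B.subspace_perp[OF q(3) R])
      have vel: "velocity B I \<sigma> s \<in> ?R"
        unfolding rangeF_def velocity_\<sigma>[OF elim(3)]
        by (rule imageI) (rule velocity_tangent[OF N.manifold I(1) \<gamma>_smooth elim(3)])
      have FY1: "FY1 t ?q \<in> ?R"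
      proof -
        have "FY1 t ?q = push B F ?y (Y1 t ?y)" using Y1 t elim(2) q(1) by simp
        moreover have "Y1 t ?y \<in> N.T ?y" by (rule smooth_field_on_tangent[of N "U t"]) (use Y1 t elim(2) in auto)
        ultimately show ?thesis by (simp add: rangeF_def)
      qed
      have "Z t ?q \<in> ?P" using Z t q D_q unfolding section_on_def by auto
      moreover have "Z t ?q = velocity B I \<sigma> s - FY1 t ?q" using elim by simp
      then have "Z t ?q \<in> ?R" using subspace_diff[OF sub(1) vel FY1] by simp
      ultimately have Z0: "Z t ?q = 0" by (rule B.perp_disjoint[OF q(3)])
      have "\<forall>u\<in>B.T ?q. \<forall>a. \<phi> ?q (a *\<^sub>R u) = a *\<^sub>R \<phi> ?q u"
        using B q(3) unfolding sasakian_manifold_def by simp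
      then have "\<phi> ?q 0 = 0" by (metis scaleR_zero_left zero_tangent)
      then have BC: "BZ t ?q = - CZ t ?q"
        using phiZ t q(2) Z0 by (metis add.inverse_unique add.commute)
      have "CZ t ?q \<in> ?P" using CZ t q D_q unfolding section_on_def by auto
      then have "BZ t ?q \<in> ?P" unfolding BC by (rule subspace_neg[OF sub(2)])
      moreover have "BZ t ?q \<in> ?R"
      proof -
        have "push B F ?y (Y t ?y) = BZ t ?q" using Y t elim q(1) by auto
        moreover have "Y t ?y \<in> N.T ?y" using Y t elim unfolding section_on_def perp_def by auto
        ultimately show ?thesis unfolding rangeF_def by (metis imageI)
      qed
      ultimately have B0: "BZ t ?q = 0" by (rule B.perp_disjoint[OF q(3)])
      have \<xi>: "\<xi> ?q \<in> ?P" using reeb q by simp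
      then have "gB ?q (FY1 t ?q) (\<xi> ?q) = 0"
        using FY1 R B.g_sym[OF q(3), of "FY1 t ?q" "\<xi> ?q"] by (auto simp: perp_def)
      then show ?case using elim(1) Z0 B0 BC by simp
    qed
  qed
  have at_t: "velocity B I \<sigma> t = FY1 t (\<sigma> t)" "Z t (\<sigma> t) = 0" "BZ t (\<sigma> t) = 0"
    if t: "t \<in> I" for t
    using eventually_near_self[OF along[OF t]] t by auto
  have "geodesic B nabB I \<sigma> \<longleftrightarrow> (\<forall>t\<in>I. nabB (\<sigma> t) (FY1 t (\<sigma> t)) (FY1 t) = 0)"
    by (rule B.geodesic_iff[OF I(1) \<sigma>_smooth fields(3)])
       (auto intro: eventually_mono[OF along])
  also have "\<dots> \<longleftrightarrow> (\<forall>t\<in>I. nabB (\<sigma> t) (FY1 t (\<sigma> t)) (\<lambda>q. \<phi> q (FY1 t q)) =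
      gB (\<sigma> t) (FY1 t (\<sigma> t)) (FY1 t (\<sigma> t)) *\<^sub>R \<xi> (\<sigma> t))"
    by (intro ball_cong refl acceleration_eq_0_iff_sasakian[OF B I(1) _ \<sigma>_smooth fields(3)])
       (auto simp: at_t intro: eventually_mono[OF along])
  finally have geodesic_iff: "geodesic B nabB I \<sigma> \<longleftrightarrow> \<dots>" .
  show ?thesis
    unfolding geodesic_iff Let_def
  proof (rule ball_cong[OF refl])
    fix t assume t: "t \<in> I"
    let ?y = "\<gamma> t" and ?p = "\<sigma> t"
    let ?X1 = "FY1 t ?p" and ?R = "rangeF N B F ?y"
    let ?P = "perp B gB ?p ?R"
    define C where "C = nabB ?p ?X1 (\<lambda>q. \<phi> q (FY1 t q))"
    have y: "?y \<in> pts N" "?y \<in> U t" and p: "?p \<in> pts B" and Fy: "F ?y = ?p"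
      using \<gamma>_pts[OF t] \<sigma>_pts[OF t] nbhds t by (auto simp: \<sigma>)
    have pushes: "push B F ?y (Y1 t ?y) = ?X1" "push B \<sigma> t (ddt I t) = ?X1"
    proof -
      have "FY1 t (F ?y) = push B F ?y (Y1 t ?y)" using Y1 t y(2) by simp
      then show "push B F ?y (Y1 t ?y) = ?X1" by (simp add: Fy)
      show "push B \<sigma> t (ddt I t) = ?X1" using at_t(1)[OF t] by (simp add: velocity_def)
    qed
    have X1: "?X1 \<in> B.T ?p" by (rule smooth_field_at_tangent[OF fields(3)[OF t]])
    have R: "subspace ?R" "?R \<subseteq> B.T ?p"
      using subspace_rangeF range_T[OF y(1)] Fy by auto
    obtain b where b: "finite b" "?R = span b"
      by (rule finite_spanning_set_if_dim_pos[OF R(1)])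
         (use F(1) y(1) in \<open>auto simp: riemannian_map_def\<close>)
    have P: "subspace ?P" "?P \<subseteq> B.T ?p"
      by (rule B.subspace_perp[OF p R(2)]) (auto simp: perp_def)
    have C_T: "C \<in> B.T ?p" unfolding C_def by (rule B.nab_tangent[OF X1 fields(6)[OF t]])
    have proj_0: "orth_proj gB ?p S 0 = 0" if "subspace S" "S \<subseteq> B.T ?p" for S
      by (rule B.orth_proj_eqI[OF p that]) (use that in \<open>auto simp: subspace_0 B.g_zero_left[OF p] simp del: zero_fun_apply\<close>)
    have nab_BZ: "nabB ?p ?X1 (BZ t) = 0" and nab_CZ: "nabB ?p ?X1 (CZ t) = 0"
      using B.nab_eq_0_if_vanishes_along[OF J \<sigma>_smooth _ ddt_tangent[OF I(1) t] fields(3)[OF t], of "BZ t"]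
        B.nab_eq_0_if_vanishes_along[OF J \<sigma>_smooth _ ddt_tangent[OF I(1) t] fields(3)[OF t], of "CZ t"]
        fields[OF t] pushes(2) t eventually_mono[OF along[OF t]] by auto
    \<comment> \<open>\<open>Y\<close> vanishes along \<open>\<gamma>\<close>, but \<open>Y\<^sub>1 - \<gamma>'\<close> may be a nonzero vertical vector, in whose direction
      \<open>Y\<close> is controlled only through \<open>\<bar>Y\<bar> = \<bar>BZ\<bar> \<circ> F\<close>\<close>
    have nab_Y: "nabN ?y (Y1 t ?y) (Y t) = 0"
    proof -
      have sec: "Y t q \<in> perp N gN q (kerF N B F q)" "push B F q (Y t q) = BZ t (F q)" if "q \<in> U t" for q
        using Y t that unfolding section_on_def by auto
      have norm_Y: "gN q (Y t q) (Y t q) = gB (F q) (BZ t (F q)) (BZ t (F q))" if "q \<in> U t" for q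
      proof -
        have "q \<in> pts N" using nbhds t that openin_subset by blast
        then have "gB (F q) (push B F q (Y t q)) (push B F q (Y t q)) = gN q (Y t q) (Y t q)"
          using F(1) sec(1)[OF that] unfolding riemannian_map_def by blast
        then show ?thesis using sec(2)[OF that] by simp
      qed
      have YT: "Y t ?y \<in> N.T ?y" by (rule smooth_field_at_tangent[OF fields(2)[OF t]])
      have "gN ?y (Y t ?y) (Y t ?y) = 0"
        using norm_Y[OF y(2)] at_t(3)[OF t] Fy B.g_zero_left[OF p zero_tangent] by simp
      then have Y0: "Y t ?y = 0" using N.g_eq_0[OF y(1) YT] by simp
      have "gN ?y (nabN ?y (Y1 t ?y) (Y t)) (nabN ?y (Y1 t ?y) (Y t)) =
          gB (F ?y) (nabB (F ?y) (FY1 t (F ?y)) (BZ t)) (nabB (F ?y) (FY1 t (F ?y)) (BZ t))"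
        by (rule nab_norm_eq_at_zero_of_related_fields[OF N.riemannian_axioms B.riemannian_axioms F_smooth, of "U t" _ _ "W t"])
           (use Y1 Y BZ t nbhds y Y0 at_t(3)[OF t] Fy norm_Y in \<open>auto simp: section_on_def\<close>)
      also have "\<dots> = 0" using nab_BZ B.g_zero_left[OF p zero_tangent] Fy by simp
      finally show ?thesis
        using N.g_eq_0[OF y(1) N.nab_tangent[OF smooth_field_at_tangent[OF fields(1)[OF t]] fields(2)[OF t]]]
        by simp
    qed
    have push_0: "push B F ?y 0 = 0" by (rule linear_0[OF linear_push])
    have H_0: "orth_proj gN ?y (perp N gN ?y (kerF N B F ?y)) 0 = 0"
    proof (rule N.orth_proj_eqI[OF y(1)])
      show "subspace (perp N gN ?y (kerF N B F ?y))"
        by (rule N.subspace_perp[OF y(1)]) (auto simp: kerF_def)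
      then show "0 \<in> perp N gN ?y (kerF N B F ?y)" by (rule subspace_0)
    qed (auto simp: perp_def N.g_zero_left[OF y(1)] simp del: zero_fun_apply)
    have sff: "second_fundamental_form N nabN B nabB F (Y1 t) (Y t) ?y = 0"
    proof -
      have "pullback_cov N B nabB F ?y (Y1 t ?y) (\<lambda>q. push B F q (Y t q)) =
          nabB (F ?y) (push B F ?y (Y1 t ?y)) (BZ t)"
        by (rule B.pullback_cov_eq[OF N.manifold F_smooth y(1) smooth_field_at_tangent[OF fields(1)[OF t]]])
           (use fields[OF t] pushes Fy Y t y nbhds in \<open>auto intro!: eventually_nearI[of _ "U t"]\<close>)
      then show ?thesis
        unfolding second_fundamental_form_def using nab_BZ nab_Y push_0 pushes Fy by simp
    qed
    have \<eta>0: "\<eta> ?p 0 = 0"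
    proof -
      have "\<forall>u\<in>B.T ?p. \<forall>a. \<eta> ?p (a *\<^sub>R u) = a * \<eta> ?p u"
        using B p unfolding sasakian_manifold_def by simp
      then show ?thesis by (metis mult_zero_left scaleR_zero_left zero_tangent)
    qed
    have nab_0: "nabB ?p 0 V = 0" if "smooth_field_at B ?p V" for V by (rule B.nab_zero_left[OF that])
    define v where "v = gB ?p ?X1 ?X1"
    let ?C1 = "orth_proj gB ?p ?R C" and ?C2 = "orth_proj gB ?p ?P C"
    have shapes: "shape N B gB nabB F ?y (\<lambda>q. \<phi> q (FY1 t q)) ?X1 = - ?C1"
        "shape N B gB nabB F ?y (CZ t) ?X1 = 0"
      unfolding shape_def Fy C_def nab_CZ proj_0[OF R] by simp_all
    have normals: "normal_cov N B gB nabB F ?y ?X1 (\<lambda>q. \<phi> q (FY1 t q)) = ?C2"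
        "normal_cov N B gB nabB F ?y ?X1 (CZ t) = 0"
        "normal_cov N B gB nabB F ?y 0 (\<lambda>q. \<phi> q (FY1 t q)) = 0"
        "normal_cov N B gB nabB F ?y 0 (CZ t) = 0"
      unfolding normal_cov_def Fy C_def nab_CZ nab_0[OF fields(5)[OF t]] nab_0[OF fields(6)[OF t]] proj_0[OF P]
      by simp_all
    have split: "?C1 + ?C2 = C" by (rule B.orth_proj_add_perp[OF p R b(2,1) C_T])
    have \<xi>: "v *\<^sub>R \<xi> ?p \<in> ?P" using reeb y(1) Fy subspace_scale[OF P(1)] by auto
    have "C = v *\<^sub>R \<xi> ?p \<longleftrightarrow> ?C1 = 0 \<and> ?C2 = v *\<^sub>R \<xi> ?p"
    proof
      assume C: "C = v *\<^sub>R \<xi> ?p"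
      have "?C2 = v *\<^sub>R \<xi> ?p"
        by (rule B.orth_proj_eqI[OF p P C_T \<xi>])
           (use P C B.g_zero_left[OF p] in auto)
      then show "?C1 = 0 \<and> ?C2 = v *\<^sub>R \<xi> ?p" using split C by simp
    next
      assume "?C1 = 0 \<and> ?C2 = v *\<^sub>R \<xi> ?p"
      then show "C = v *\<^sub>R \<xi> ?p" using split by simp
    qed
    then show "nabB ?p ?X1 (\<lambda>q. \<phi> q (FY1 t q)) = gB ?p ?X1 ?X1 *\<^sub>R \<xi> ?p \<longleftrightarrow>
      - shape N B gB nabB F ?y (\<lambda>q. \<phi> q (FY1 t q)) ?X1 - shape N B gB nabB F ?y (CZ t) ?X1
        + nabB ?p (Z t ?p) (BZ t)
        + push B F ?y (orth_proj gN ?y (perp N gN ?y (kerF N B F ?y)) (nabN ?y (Y1 t ?y) (Y t)))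
        + \<eta> ?p (Z t ?p) *\<^sub>R ?X1 = 0
    \<and>
      second_fundamental_form N nabN B nabB F (Y1 t) (Y t) ?y
        + normal_cov N B gB nabB F ?y ?X1 (\<lambda>q. \<phi> q (FY1 t q))
        + normal_cov N B gB nabB F ?y (Z t ?p) (\<lambda>q. \<phi> q (FY1 t q))
        + normal_cov N B gB nabB F ?y (Z t ?p) (CZ t)
        + normal_cov N B gB nabB F ?y ?X1 (CZ t)
        - gB ?p (velocity B I \<sigma> t) (velocity B I \<sigma> t) *\<^sub>R \<xi> ?p + \<eta> ?p (Z t ?p) *\<^sub>R Z t ?p = 0"
      unfolding at_t[OF t] shapes normals sff nab_Y nab_0[OF fields(4)[OF t]] H_0 push_0 \<eta>0
        v_def[symmetric] C_def[symmetric]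
      by simp
  qed
qed

end
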